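(* Let $\mu,\nu\in\mathbb{C}$, and let $(b_m)_{m\ge 0}$, $(a_n^{\mu,\nu})_{n\ge 0}$ and $(c_n^{\mu,\nu})_{n\ge 0}$ be sequences of complex numbers. Suppose that $$f(z)=\sum_{m=0}^{\infty} b_m z^m$$ and $$z^{\mu+\nu}f(z)=\sum_{n=0}^{\infty}\left(a_n^{\mu,\nu}+z\,c_n^{\mu,\nu}\right)\mathrm{J}_{\mu+n}\left[(\mu+\nu+2n)z\right]\,\mathrm{J}_{\nu+n}\left[(\mu+\nu+2n)z\right],$$ where both series converge absolutely for $z$ in some domain $\Omega\subseteq\mathbb{C}$. For integers $0\le k\le s$ put $$\alpha_{s,k}^{\mu,\nu}=\frac{(\mu+\nu+2k)^2\,\Gamma(\mu+k+1)\,\Gamma(\nu+k+1)}{(\mu+\nu+s+k)(\mu+\nu+2s)}\binom{\mu+\nu+s+k}{s-k}\left(\frac{2}{\mu+\nu+2s}\right)^{\mu+\nu+2k}$$ and $$\beta_{s,k}^{\mu,\nu}=\frac{(-1)^{s+k}}{\Gamma(\mu+s+1)\,\Gamma(\nu+s+1)}\binom{\mu+\nu+2s}{s-k}\left(\frac{\mu+\nu+2k}{2}\right)^{\mu+\nu+2s}.$$ Then, for all $\mu,\nu$ and every integer $s\ge 0$, $$a_s^{\mu,\nu}=\sum_{k=0}^{s}\alpha_{s,k}^{\mu,\nu}\,b_{2k},\qquad c_s^{\mu,\nu}=\sum_{k=0}^{s}\alpha_{s,k}^{\mu,\nu}\,b_{2k+1}$$ and $$b_{2s}=\sum_{k=0}^{s}\beta_{s,k}^{\mu,\nu}\,a_k^{\mu,\nu},\qquad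 b_{2s+1}=\sum_{k=0}^{s}\beta_{s,k}^{\mu,\nu}\,c_k^{\mu,\nu}.$$
   Context: For $\nu\in\mathbb{C}$ the Bessel function of the first kind is $$\mathrm{J}_{\nu}(z)=\sum_{n=0}^{\infty}\frac{(-1)^n}{n!\,\Gamma(\nu+n+1)}\left(\frac z2\right)^{\nu+2n},$$ where $\Gamma$ is the Gamma function and $1/\Gamma$ is taken to be $0$ at the poles of $\Gamma$. For $x\in\mathbb{C}$ and an integer $j\ge 0$, $\binom{x}{j}=\frac{x(x-1)\cdots(x-j+1)}{j!}$. Conventions for formulas: $0^0=1$. Complex powers are taken with consistent branches, so that, with $w=\mu+\nu+2n$, the product $\left(\frac{wz}{2}\right)^{\mu+n}\left(\frac{wz}{2}\right)^{\nu+n}$ equals $\left(\frac{w}{2}\right)^{\mu+\nu+2n}z^{\mu+\nu+2n}$, $z^{\mu+\nu+j}=z^{\mu+\nu}z^{j}$ for integers $j$, and $(2/w)^{c}=(w/2)^{-c}$. Each of the asserted identities is understood for those values of $\mu,\nu$ (and $s$) for which the expressions occurring in it are defined (for example, $\alpha_{0,0}^{\mu,\nu}$ is not defined by the formula when $\mu+\nu=0$). *)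

theory Defs
  imports "HOL-Analysis.Analysis"
begin

text \<open>
  Complex powers are taken with respect to an arbitrary choice \<open>lg\<close> of the logarithm, that is,
  a function with \<open>exp (lg x) = x\<close> for \<open>x \<noteq> 0\<close> (no continuity is assumed; \<^term>\<open>Ln\<close> is one
  instance). Unlike for \<^term>\<open>(powr)\<close>, the power \<open>0\<close> to the \<open>0\<close> is \<open>1\<close> here.
\<close>

definition is_log :: "(complex \<Rightarrow> complex) \<Rightarrow> bool" where
  "is_log lg \<longleftrightarrow> (\<forall>x. x \<noteq> 0 \<longrightarrow> exp (lg x) = x)"

definition cpow :: "(complex \<Rightarrow> complex) \<Rightarrow> complex \<Rightarrow> complex \<Rightarrow> complex" where
  "cpow lg x c = (if c = 0 then 1 else if x = 0 then 0 else exp (c * lg x))"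

lemma is_log_Ln: "is_log Ln"
  by (simp add: is_log_def)

lemma cpow_Ln: "x \<noteq> 0 \<Longrightarrow> cpow Ln x c = x powr c"
  by (simp add: cpow_def powr_def)

lemma cpow_of_nat: "is_log lg \<Longrightarrow> cpow lg x (of_nat n) = x ^ n"
  by (auto simp: cpow_def is_log_def exp_of_nat_mult)

lemma cpow_add_of_nat:
  assumes "is_log lg" "x \<noteq> 0"
  shows   "cpow lg x (c + of_nat n) = cpow lg x c * x ^ n"
proof -
  have "cpow lg x d = exp (d * lg x)" for d
    using assms(2) by (simp add: cpow_def)
  thus ?thesis
    using assms by (simp add: is_log_def ring_distribs exp_add exp_of_nat_mult)
qed

text \<open>
  \<open>bessel_J_log \<nu> l\<close> is the value of the Bessel function of the first kind of order \<open>\<nu>\<close> at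
  \<open>x = 2 * exp l\<close> on the branch where the power of \<open>x / 2\<close> with exponent \<open>c\<close> is \<open>exp (c * l)\<close>.
\<close>

definition bessel_J_log :: "complex \<Rightarrow> complex \<Rightarrow> complex" where
  "bessel_J_log \<nu> l =
     (\<Sum>n. (-1) ^ n / fact n * rGamma (\<nu> + of_nat n + 1) * exp ((\<nu> + 2 * of_nat n) * l))"

lemma bessel_J_log_Ln:
  assumes "z \<noteq> 0"
  shows "bessel_J_log \<nu> (Ln (z / 2)) =
     (\<Sum>n. (-1) ^ n / fact n * rGamma (\<nu> + of_nat n + 1) * (z / 2) powr (\<nu> + 2 * of_nat n))"
  using assms by (simp add: bessel_J_log_def powr_def)

text \<open>
  The product of the Bessel functions of orders \<open>\<mu> + n\<close> and \<open>\<nu> + n\<close> at \<open>w * z\<close>, where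
  \<open>w = \<mu> + \<nu> + 2 * n\<close> and \<open>z \<noteq> 0\<close>. Taking \<open>lg (w / 2) + lg z\<close> as the logarithm of \<open>w * z / 2\<close>
  makes the powers of \<open>w * z / 2\<close> split into powers of \<open>w / 2\<close> and of \<open>z\<close>. For \<open>w = 0\<close> the power
  of \<open>w * z / 2\<close> in the product of the two leading terms has exponent \<open>0\<close>, so it is \<open>1\<close>, and all
  other terms vanish; lemma \<open>bessel_JJ_eq\<close> shows that both cases obey one formula.
\<close>

definition bessel_JJ ::
    "(complex \<Rightarrow> complex) \<Rightarrow> complex \<Rightarrow> complex \<Rightarrow> nat \<Rightarrow> complex \<Rightarrow> complex" where
  "bessel_JJ lg \<mu> \<nu> n z =
     (let w = \<mu> + \<nu> + 2 * of_nat n in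
      if w = 0 then rGamma (\<mu> + of_nat n + 1) * rGamma (\<nu> + of_nat n + 1)
      else bessel_J_log (\<mu> + of_nat n) (lg (w / 2) + lg z) *
           bessel_J_log (\<nu> + of_nat n) (lg (w / 2) + lg z))"

definition bessel_entire :: "complex \<Rightarrow> complex \<Rightarrow> complex" where
  "bessel_entire \<nu> x =
     (\<Sum>n. (-1) ^ n / fact n * rGamma (\<nu> + of_nat n + 1) * (x / 2) ^ (2 * n))"

lemma summable_bessel_entire:
  "summable (\<lambda>n. (-1) ^ n / fact n * rGamma (\<nu> + of_nat n + 1) * (x / 2 :: complex) ^ (2 * n))"
    (is "summable ?f")
proof -
  obtain N :: nat where N: "real N \<ge> norm \<nu> + 1 + 2 * norm ((x / 2)\<^sup>2)"
    using real_arch_simple by blast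
  show ?thesis
  proof (rule summable_ratio_test[of "1/2" N])
    fix n assume "n \<ge> N"
    let ?z = "\<nu> + of_nat n + 1"
    let ?C = "norm ((-1) ^ n / fact n :: complex) * norm (rGamma (?z + 1)) * norm ((x / 2) ^ (2 * n))"
    have "real n - norm \<nu> \<le> norm (\<nu> + of_nat n)"
      using norm_diff_ineq[of "of_nat n" \<nu>] by (simp add: add.commute)
    hence z: "norm ?z \<ge> 2 * norm ((x / 2)\<^sup>2)"
      using N \<open>n \<ge> N\<close> norm_diff_ineq[of "\<nu> + of_nat n" 1] by simp
    have "?f n = (-1) ^ n / fact n * (?z * rGamma (?z + 1)) * (x / 2) ^ (2 * n)"
      by (simp only: rGamma_plus1)
    hence fn: "norm (?f n) = norm ?z * ?C"
      by (simp only: norm_mult mult_ac)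
    have "(-1) ^ Suc n / fact (Suc n) = - ((-1) ^ n / fact n) / (of_nat (Suc n) :: complex)"
      by (simp del: of_nat_Suc)
    hence sgn: "norm ((-1) ^ Suc n / fact (Suc n) :: complex) =
        norm ((-1) ^ n / fact n :: complex) / real (Suc n)"
      by (simp only: norm_divide norm_minus_cancel norm_of_nat)
    have "\<nu> + of_nat (Suc n) + 1 = ?z + 1" "(x / 2) ^ (2 * Suc n) = (x / 2)\<^sup>2 * (x / 2) ^ (2 * n)"
      by (simp_all add: power2_eq_square)
    hence "norm (?f (Suc n)) = norm ((x / 2)\<^sup>2) / real (Suc n) * ?C"
      by (simp only: norm_mult sgn) (simp only: divide_inverse mult_ac)
    also have "\<dots> \<le> norm ?z / 2 * ?C"
    proof (rule mult_right_mono)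
      have "norm ((x / 2)\<^sup>2) / real (Suc n) \<le> norm ((x / 2)\<^sup>2) / 1"
        by (intro divide_left_mono) auto
      thus "norm ((x / 2)\<^sup>2) / real (Suc n) \<le> norm ?z / 2"
        using z by linarith
    qed (intro mult_nonneg_nonneg norm_ge_zero)
    finally show "norm (?f (Suc n)) \<le> 1 / 2 * norm (?f n)"
      unfolding fn by linarith
  qed simp
qed

lemma bessel_J_log_eq: "bessel_J_log \<nu> l = exp (\<nu> * l) * bessel_entire \<nu> (2 * exp l)"
proof -
  have "exp ((\<nu> + 2 * of_nat n) * l) = exp (\<nu> * l) * exp l ^ (2 * n)" for n
    using exp_of_nat_mult[of "2 * n" l] by (simp add: ring_distribs exp_add)
  thus ?thesis
    unfolding bessel_J_log_def bessel_entire_def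
    using suminf_mult[OF summable_bessel_entire[of \<nu> "2 * exp l"], of "exp (\<nu> * l)"]
    by (simp add: mult_ac)
qed

lemma bessel_JJ_eq:
  fixes \<mu> \<nu> :: complex
  assumes "is_log lg" "z \<noteq> 0"
  defines "w \<equiv> \<lambda>n. \<mu> + \<nu> + 2 * of_nat n"
  shows "bessel_JJ lg \<mu> \<nu> n z = cpow lg (w n / 2) (w n) * cpow lg z (w n) *
           bessel_entire (\<mu> + of_nat n) (w n * z) * bessel_entire (\<nu> + of_nat n) (w n * z)"
proof (cases "w n = 0")
  case True
  have "bessel_entire c 0 = rGamma (c + 1)" for c
    unfolding bessel_entire_def by (subst suminf_finite[of "{0}"]) auto
  with True show ?thesis
    by (simp add: bessel_JJ_def cpow_def w_def add_ac)
next
  case False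
  define l where "l = lg (w n / 2) + lg z"
  have arg: "2 * exp l = w n * z"
    using assms(1,2) False by (simp add: is_log_def exp_add l_def)
  have pow: "exp ((\<mu> + of_nat n) * l) * exp ((\<nu> + of_nat n) * l) =
               cpow lg (w n / 2) (w n) * cpow lg z (w n)"
    using False assms(2) by (simp add: cpow_def l_def w_def algebra_simps flip: exp_add)
  have "bessel_JJ lg \<mu> \<nu> n z =
          bessel_J_log (\<mu> + of_nat n) l * bessel_J_log (\<nu> + of_nat n) l"
    using False by (simp add: bessel_JJ_def l_def w_def Let_def)
  thus ?thesis
    unfolding bessel_J_log_eq arg pow[symmetric] by (simp only: mult_ac)
qed

text \<open>
  The power of \<open>2 / w\<close> with exponent \<open>c\<close> is that of \<open>w / 2\<close> with exponent \<open>-c\<close>.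
  \<open>alpha_defined\<close> says that no denominator vanishes and no Gamma function is evaluated at a pole.
\<close>

definition alpha_defined :: "complex \<Rightarrow> complex \<Rightarrow> nat \<Rightarrow> nat \<Rightarrow> bool" where
  "alpha_defined \<mu> \<nu> s k \<longleftrightarrow>
     \<mu> + of_nat k + 1 \<notin> \<int>\<^sub>\<le>\<^sub>0 \<and> \<nu> + of_nat k + 1 \<notin> \<int>\<^sub>\<le>\<^sub>0 \<and>
     \<mu> + \<nu> + of_nat s + of_nat k \<noteq> 0 \<and> \<mu> + \<nu> + 2 * of_nat s \<noteq> 0"

definition alpha ::
    "(complex \<Rightarrow> complex) \<Rightarrow> complex \<Rightarrow> complex \<Rightarrow> nat \<Rightarrow> nat \<Rightarrow> complex" where
  "alpha lg \<mu> \<nu> s k =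
     (\<mu> + \<nu> + 2 * of_nat k)\<^sup>2 * Gamma (\<mu> + of_nat k + 1) * Gamma (\<nu> + of_nat k + 1) /
       ((\<mu> + \<nu> + of_nat s + of_nat k) * (\<mu> + \<nu> + 2 * of_nat s)) *
     ((\<mu> + \<nu> + of_nat s + of_nat k) gchoose (s - k)) *
     cpow lg ((\<mu> + \<nu> + 2 * of_nat s) / 2) (- (\<mu> + \<nu> + 2 * of_nat k))"

definition beta ::
    "(complex \<Rightarrow> complex) \<Rightarrow> complex \<Rightarrow> complex \<Rightarrow> nat \<Rightarrow> nat \<Rightarrow> complex" where
  "beta lg \<mu> \<nu> s k =
     (-1) ^ (s + k) * rGamma (\<mu> + of_nat s + 1) * rGamma (\<nu> + of_nat s + 1) *
     ((\<mu> + \<nu> + 2 * of_nat s) gchoose (s - k)) *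
     cpow lg ((\<mu> + \<nu> + 2 * of_nat k) / 2) (\<mu> + \<nu> + 2 * of_nat s)"

end

theory Submission
  imports Defs "HOL-Complex_Analysis.Complex_Analysis"
begin

text \<open>
  Divided by \<open>z\<close> to the power \<open>\<mu> + \<nu>\<close>, the \<open>n\<close>-th Bessel product is, up to a constant, an entire
  function \<open>F\<^sub>n\<close> with a zero of order at least \<open>2 * n\<close> at \<open>0\<close>; its Taylor coefficients are given by
  Vandermonde's identity. The formula for \<open>b\<close> in terms of \<open>a\<close> and \<open>c\<close> is therefore a comparison of
  Taylor coefficients at \<open>0\<close>. Since \<open>\<Omega>\<close> need not be near \<open>0\<close>, convergence has to be transported
  from \<open>\<Omega>\<close> to \<open>0\<close>, along rays that avoid the real axis. Along such a ray put
  \<open>e z = bessel_entire p (w * z)\<close>, \<open>d z = bessel_theta p (w * z) / n\<close> and \<open>r z = csqrt (1 - 4 * z\<^sup>2)\<close>.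
  Up to bounded errors Bessel's equation becomes
  \<open>z * X' = (n * r - p) * X\<close>, \<open>z * Y' = - (n * r + p) * Y\<close> for \<open>X = d + r * e\<close>, \<open>Y = d - r * e\<close>.
  As \<open>Re r > 0\<close>, the cone \<open>norm Y < \<epsilon> * norm X\<close> is invariant for large \<open>n\<close>, so \<open>e\<close> has no zeros
  there and \<open>d / e\<close> is close to \<open>r\<close>. Hence the logarithmic derivative of \<open>F\<^sub>n\<close> is of exact
  order \<open>n\<close> with positive real part in the radial direction: \<open>norm (F\<^sub>n (t * z))\<close> is at most
  \<open>t powr (\<delta> * n) * norm (F\<^sub>n z)\<close>. So the Kapteyn series converges locally uniformly on the open
  cone over a ball in \<open>\<Omega>\<close>, agrees there with the power series, and its tails vanish to any
  prescribed order at \<open>0\<close> along a ray.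

  The formulas for \<open>a\<close> and \<open>c\<close> follow because \<open>\<alpha>\<close> and \<open>\<beta>\<close> are inverse triangular matrices. The
  product \<open>\<beta> \<alpha>\<close> is evaluated as a divided difference, which is possible only if no denominator
  vanishes; this gives \<open>\<alpha> \<beta> = 1\<close> for infinitely many values of \<open>\<mu> + \<nu>\<close>, and after clearing
  denominators the latter is a polynomial identity in \<open>\<mu> + \<nu>\<close>.
\<close>

section \<open>The Bessel--Clifford function\<close>

definition clifford_coeff :: "complex \<Rightarrow> nat \<Rightarrow> complex" where
  "clifford_coeff p k = (-1) ^ k / fact k * rGamma (p + of_nat k + 1)"

text \<open>This is the classical Bessel--Clifford function at \<open>- x\<close>.\<close>

definition bessel_clifford :: "complex \<Rightarrow> complex \<Rightarrow> complex" where
  "bessel_clifford p x = (\<Sum>k. clifford_coeff p k * x ^ k)"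

text \<open>In the variable \<open>(x / 2)\<^sup>2\<close> the even series becomes an ordinary power
  series, to which termwise differentiation and the Cauchy product apply directly.\<close>

lemma bessel_entire_eq: "bessel_entire p x = bessel_clifford p ((x / 2)\<^sup>2)"
  by (simp add: bessel_entire_def bessel_clifford_def clifford_coeff_def power_mult)

lemma summable_bessel_clifford: "summable (\<lambda>k. clifford_coeff p k * x ^ k)"
proof -
  \<comment> \<open>Every \<open>x\<close> has the form \<open>(y / 2)\<^sup>2\<close> with
    \<open>y = 2 * csqrt x\<close>, so convergence is inherited from the even series.\<close>
  have "(2 * csqrt x / 2) ^ (2 * k) = x ^ k" for k
    by (simp add: power_mult)
  thus ?thesis
    using summable_bessel_entire[of p "2 * csqrt x"] by (simp add: clifford_coeff_def)
qed

lemma summable_norm_bessel_clifford: "summable (\<lambda>k. norm (clifford_coeff p k * x ^ k))"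
  by (rule powser_insidea[OF summable_bessel_clifford[of p "of_real (norm x + 1)"]])
     (simp del: of_real_add)

text \<open>The factor \<open>Suc k\<close> cancels against the factorial, and the index shift
  inside the reciprocal Gamma function acts as a shift of the order.\<close>

lemma diffs_clifford_coeff: "diffs (clifford_coeff p) = (\<lambda>k. - clifford_coeff (p + 1) k)"
proof
  fix k
  have "of_nat (Suc k) * (1 / fact (Suc k) :: complex) = 1 / fact k"
    by (simp del: of_nat_Suc)
  hence "of_nat (Suc k) * ((-1) ^ Suc k / fact (Suc k) :: complex) = - ((-1) ^ k / fact k)"
    by (simp add: field_simps del: of_nat_Suc)
  thus "diffs (clifford_coeff p) k = - clifford_coeff (p + 1) k"
    by (simp add: diffs_def clifford_coeff_def mult.assoc[symmetric] add_ac del: of_nat_Suc)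
       (simp add: add_ac)
qed

lemma bessel_clifford_has_field_derivative:
  "(bessel_clifford p has_field_derivative - bessel_clifford (p + 1) x) (at x)"
proof -
  have "(\<Sum>k. - clifford_coeff (p + 1) k * x ^ k) = - bessel_clifford (p + 1) x"
    unfolding bessel_clifford_def using suminf_minus[OF summable_bessel_clifford] by simp
  thus ?thesis
    using termdiffs_strong_converges_everywhere[of "clifford_coeff p" x, OF summable_bessel_clifford]
    by (simp add: diffs_clifford_coeff bessel_clifford_def[abs_def])
qed

lemma bessel_clifford_has_field_derivative' [derivative_intros]:
  assumes "(g has_field_derivative g') (at x within A)"
  shows "((\<lambda>x. bessel_clifford p (g x)) has_field_derivative
           - bessel_clifford (p + 1) (g x) * g') (at x within A)"
  using DERIV_chain2[OF bessel_clifford_has_field_derivative assms] by simp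

text \<open>The functional equation of \<open>rGamma\<close> gives each coefficient a factor
  \<open>p + 1 + k\<close>. Its part \<open>k\<close> corresponds to \<open>x\<close> times the
  derivative, which shifts the order once more and changes the sign.\<close>

lemma bessel_clifford_recurrence:
  "bessel_clifford p x = (p + 1) * bessel_clifford (p + 1) x - x * bessel_clifford (p + 2) x"
proof -
  have rec: "clifford_coeff p k = (p + 1 + of_nat k) * clifford_coeff (p + 1) k" for k
    using rGamma_plus1[of "p + of_nat k + 1"]
    by (simp add: clifford_coeff_def algebra_simps)
  have shift: "of_nat (Suc k) * clifford_coeff (p + 1) (Suc k) = - clifford_coeff (p + 2) k" for k
    using fun_cong[OF diffs_clifford_coeff[of "p + 1"], of k] by (simp add: diffs_def add_ac)
  have "(\<lambda>k. clifford_coeff (p + 2) k * x ^ k) sums bessel_clifford (p + 2) x"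
    unfolding bessel_clifford_def by (rule summable_sums[OF summable_bessel_clifford])
  hence "(\<lambda>k. - x * (clifford_coeff (p + 2) k * x ^ k)) sums (- x * bessel_clifford (p + 2) x)"
    by (rule sums_mult)
  moreover have "- x * (clifford_coeff (p + 2) k * x ^ k) =
      of_nat (Suc k) * clifford_coeff (p + 1) (Suc k) * x ^ Suc k" for k
    by (simp only: shift) simp
  ultimately have "(\<lambda>k. of_nat k * clifford_coeff (p + 1) k * x ^ k) sums
      (- x * bessel_clifford (p + 2) x)"
    using sums_Suc_iff[of "\<lambda>k. of_nat k * clifford_coeff (p + 1) k * x ^ k"] by simp
  moreover have "(\<lambda>k. (p + 1) * (clifford_coeff (p + 1) k * x ^ k)) sums
      ((p + 1) * bessel_clifford (p + 1) x)"
    unfolding bessel_clifford_def by (intro sums_mult summable_sums summable_bessel_clifford)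
  ultimately have "(\<lambda>k. (p + 1) * (clifford_coeff (p + 1) k * x ^ k) +
        of_nat k * clifford_coeff (p + 1) k * x ^ k) sums
      ((p + 1) * bessel_clifford (p + 1) x + - x * bessel_clifford (p + 2) x)"
    by (intro sums_add)
  hence "(\<lambda>k. clifford_coeff p k * x ^ k) sums
      ((p + 1) * bessel_clifford (p + 1) x + - x * bessel_clifford (p + 2) x)"
    by (simp add: rec ring_distribs mult.assoc)
  thus ?thesis
    by (simp add: sums_unique[symmetric] bessel_clifford_def[of p])
qed

lemma bessel_clifford_0: "bessel_clifford p 0 = rGamma (p + 1)"
  unfolding bessel_clifford_def powser_zero by (simp add: clifford_coeff_def)

text \<open>Raising both reciprocal Gamma factors to the index \<open>m\<close> leaves two binomial
  coefficients, whose sum is Vandermonde's.\<close>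

lemma clifford_coeff_convolution:
  "(\<Sum>i\<le>m. clifford_coeff p i * clifford_coeff q (m - i)) =
     (-1) ^ m * rGamma (p + of_nat m + 1) * rGamma (q + of_nat m + 1) *
     ((p + q + 2 * of_nat m) gchoose m)"
proof -
  have rG: "rGamma (c + of_nat i + 1) / fact j =
      rGamma (c + of_nat m + 1) * ((c + of_nat m) gchoose j)" if "i + j = m" for c :: complex and i j
  proof -
    have m: "of_nat m = of_nat i + (of_nat j :: complex)"
      using that by (simp flip: of_nat_add)
    have "rGamma (c + of_nat i + 1) = pochhammer (c + of_nat i + 1) j * rGamma (c + of_nat m + 1)"
      using pochhammer_rGamma[of "c + of_nat i + 1" j] by (simp add: m add_ac)
    moreover have "(c + of_nat m) gchoose j = pochhammer (c + of_nat i + 1) j / fact j"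
      by (simp add: gbinomial_pochhammer' m add_ac)
    ultimately show ?thesis by simp
  qed
  have "clifford_coeff p i * clifford_coeff q (m - i) =
      (-1) ^ m * rGamma (p + of_nat m + 1) * rGamma (q + of_nat m + 1) *
      (((q + of_nat m) gchoose i) * ((p + of_nat m) gchoose (m - i)))" if "i \<le> m" for i
  proof -
    \<comment> \<open>The factorials are exchanged between the two factors:
      \<open>fact (m - i)\<close>, which comes with \<open>q\<close>, completes the Gamma factor of
      \<open>p\<close> to a binomial coefficient, and conversely.\<close>
    have "clifford_coeff p i * clifford_coeff q (m - i) = ((-1) ^ i * (-1) ^ (m - i)) *
        (rGamma (p + of_nat i + 1) / fact (m - i)) * (rGamma (q + of_nat (m - i) + 1) / fact i)"
      by (simp add: clifford_coeff_def mult_ac)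
    also have "(-1) ^ i * (-1) ^ (m - i) = ((-1) ^ m :: complex)"
      using that by (simp flip: power_add)
    also have "rGamma (p + of_nat i + 1) / fact (m - i) =
        rGamma (p + of_nat m + 1) * ((p + of_nat m) gchoose (m - i))"
      using that by (intro rG) simp
    also have "rGamma (q + of_nat (m - i) + 1) / fact i =
        rGamma (q + of_nat m + 1) * ((q + of_nat m) gchoose i)"
      using that by (intro rG) simp
    finally show ?thesis
      by (simp only: mult_ac)
  qed
  hence "(\<Sum>i\<le>m. clifford_coeff p i * clifford_coeff q (m - i)) =
      (-1) ^ m * rGamma (p + of_nat m + 1) * rGamma (q + of_nat m + 1) *
      (\<Sum>i=0..m. ((q + of_nat m) gchoose i) * ((p + of_nat m) gchoose (m - i)))"
    by (simp add: sum_distrib_left atMost_atLeast0)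
  thus ?thesis
    by (simp add: gbinomial_Vandermonde) (simp add: add_ac)
qed

lemma bessel_clifford_mult_sums:
  "(\<lambda>m. (-1) ^ m * rGamma (p + of_nat m + 1) * rGamma (q + of_nat m + 1) *
      ((p + q + 2 * of_nat m) gchoose m) * x ^ m) sums (bessel_clifford p x * bessel_clifford q x)"
proof -
  have "(\<Sum>i\<le>m. clifford_coeff p i * x ^ i * (clifford_coeff q (m - i) * x ^ (m - i))) =
      (\<Sum>i\<le>m. clifford_coeff p i * clifford_coeff q (m - i)) * x ^ m" for m
    unfolding sum_distrib_right by (intro sum.cong) (auto simp: mult_ac simp flip: power_add)
  thus ?thesis
    using Cauchy_product_sums[OF summable_norm_bessel_clifford[of p x] summable_norm_bessel_clifford[of q x]]
    by (simp add: bessel_clifford_def clifford_coeff_convolution)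
qed

section \<open>Growth along rays\<close>

lemma DERIV_norm_square:
  fixes f :: "real \<Rightarrow> complex"
  assumes "(f has_vector_derivative f') (at t)"
  shows "((\<lambda>t. (norm (f t))\<^sup>2) has_real_derivative 2 * inner (f t) f') (at t)"
proof -
  have "((\<lambda>t. inner (f t) (f t)) has_derivative
      (\<lambda>h. inner (f t) (h *\<^sub>R f') + inner (h *\<^sub>R f') (f t))) (at t)"
    using assms unfolding has_vector_derivative_def by (rule has_derivative_inner) (use assms in \<open>simp add: has_vector_derivative_def\<close>)
  thus ?thesis
    unfolding has_field_derivative_def power2_norm_eq_inner
    by (rule has_derivative_eq_rhs) (auto simp: inner_commute algebra_simps)
qed

text \<open>Gronwall's argument: \<open>exp (- 2 * \<gamma> t) * (norm (f t))\<^sup>2\<close> is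
  nondecreasing, because its derivative is \<open>2 * (Re (g t) - \<gamma>' t)\<close> times itself.
  Squares avoid differentiating the norm at zeros of \<open>f\<close>.\<close>

lemma norm_growth:
  fixes f :: "real \<Rightarrow> complex" and \<gamma> :: "real \<Rightarrow> real"
  assumes "a \<le> b"
    and f: "\<And>t. a \<le> t \<Longrightarrow> t \<le> b \<Longrightarrow> (f has_vector_derivative g t * f t) (at t)"
    and \<gamma>: "\<And>t. a \<le> t \<Longrightarrow> t \<le> b \<Longrightarrow> (\<gamma> has_real_derivative \<gamma>' t) (at t)"
    and le: "\<And>t. a \<le> t \<Longrightarrow> t \<le> b \<Longrightarrow> \<gamma>' t \<le> Re (g t)"
  shows "norm (f a) \<le> exp (\<gamma> a - \<gamma> b) * norm (f b)"
proof -
  have "exp (- 2 * \<gamma> a) * (norm (f a))\<^sup>2 \<le> exp (- 2 * \<gamma> b) * (norm (f b))\<^sup>2"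
  proof (rule DERIV_nonneg_imp_nondecreasing[OF \<open>a \<le> b\<close>])
    fix t assume t: "a \<le> t" "t \<le> b"
    have "inner (f t) (g t * f t) = Re (g t) * (norm (f t))\<^sup>2"
      unfolding cmod_power2 by (simp add: inner_complex_def power2_eq_square algebra_simps)
    hence "((\<lambda>t. exp (- 2 * \<gamma> t) * (norm (f t))\<^sup>2) has_real_derivative
        exp (- 2 * \<gamma> t) * (2 * (Re (g t) - \<gamma>' t) * (norm (f t))\<^sup>2)) (at t)"
      by (intro DERIV_cong[OF DERIV_mult[OF _ DERIV_norm_square[OF f[OF t]]]])
         (auto intro!: derivative_eq_intros \<gamma>[OF t] simp: algebra_simps)
    moreover have "exp (- 2 * \<gamma> t) * (2 * (Re (g t) - \<gamma>' t) * (norm (f t))\<^sup>2) \<ge> 0"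
      using le[OF t] by simp
    ultimately show "\<exists>y. ((\<lambda>t. exp (- 2 * \<gamma> t) * (norm (f t))\<^sup>2) has_real_derivative y) (at t) \<and> 0 \<le> y"
      by blast
  qed
  hence "(exp (- \<gamma> a) * norm (f a))\<^sup>2 \<le> (exp (- \<gamma> b) * norm (f b))\<^sup>2"
    by (simp add: power_mult_distrib flip: exp_double)
  hence "exp (- \<gamma> a) * norm (f a) \<le> exp (- \<gamma> b) * norm (f b)"
    by (rule power2_le_imp_le) simp
  hence "exp (\<gamma> a) * (exp (- \<gamma> a) * norm (f a)) \<le> exp (\<gamma> a) * (exp (- \<gamma> b) * norm (f b))"
    by (rule mult_left_mono) simp
  thus ?thesis
    by (simp add: exp_diff exp_minus field_simps)
qed

text \<open>As long as \<open>\<epsilon>\<^sup>2 * (norm X)\<^sup>2 - (norm Y)\<^sup>2\<close> is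
  positive, its product with \<open>t ^ m\<close> is nondecreasing, so it cannot reach a first zero.
  Only \<open>t\<close> times the derivatives is controlled, as suits a system that is singular at
  \<open>t = 0\<close>; the free exponent \<open>m\<close> absorbs a multiple of the function
  itself.\<close>

lemma cone_invariant:
  fixes X Y :: "real \<Rightarrow> complex"
  assumes X: "\<And>t. 0 \<le> t \<Longrightarrow> t \<le> 1 \<Longrightarrow> (X has_vector_derivative X' t) (at t)"
    and Y: "\<And>t. 0 \<le> t \<Longrightarrow> t \<le> 1 \<Longrightarrow> (Y has_vector_derivative Y' t) (at t)"
    and start: "norm (Y 0) < \<epsilon> * norm (X 0)" and "\<epsilon> > 0"
    and step: "\<And>t. 0 < t \<Longrightarrow> t \<le> 1 \<Longrightarrow> norm (Y t) \<le> \<epsilon> * norm (X t) \<Longrightarrow>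
      0 \<le> 2 * (\<epsilon>\<^sup>2 * inner (X t) (of_real t * X' t) - inner (Y t) (of_real t * Y' t)) +
          real m * (\<epsilon>\<^sup>2 * (norm (X t))\<^sup>2 - (norm (Y t))\<^sup>2)"
    and t: "0 \<le> t" "t \<le> 1"
  shows "norm (Y t) < \<epsilon> * norm (X t)"
proof -
  define \<phi> where "\<phi> t = \<epsilon>\<^sup>2 * (norm (X t))\<^sup>2 - (norm (Y t))\<^sup>2" for t
  define \<phi>' where "\<phi>' t = 2 * (\<epsilon>\<^sup>2 * inner (X t) (X' t) - inner (Y t) (Y' t))" for t
  have \<phi>_iff: "norm (Y t) < \<epsilon> * norm (X t) \<longleftrightarrow> \<phi> t > 0" for t
    using \<open>\<epsilon> > 0\<close> abs_le_square_iff[of "\<epsilon> * norm (X t)" "norm (Y t)"]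
    by (auto simp: \<phi>_def power_mult_distrib abs_mult)
  have deriv: "(\<phi> has_real_derivative \<phi>' t) (at t)" if "0 \<le> t" "t \<le> 1" for t
    unfolding \<phi>_def \<phi>'_def
    by (intro DERIV_cong[OF DERIV_diff[OF DERIV_cmult[OF DERIV_norm_square[OF X[OF that]]]
          DERIV_norm_square[OF Y[OF that]]]]) (simp add: algebra_simps)
  have step': "0 \<le> t * \<phi>' t + real m * \<phi> t" if "0 < t" "t \<le> 1" "\<phi> t > 0" for t
  proof -
    have inner: "inner x (of_real t * y) = t * inner x y" for x y :: complex
      by (simp add: inner_complex_def algebra_simps)
    show ?thesis
      using step[OF that(1,2)] that(3) \<phi>_iff[of t] unfolding inner
      by (simp add: \<phi>_def \<phi>'_def algebra_simps)
  qed
  define S where "S = {t \<in> {0..1}. \<phi> t \<le> 0}"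
  have "S = {}"
  proof (rule ccontr)
    assume "S \<noteq> {}"
    have cont: "continuous_on {0..1} \<phi>"
      by (intro continuous_at_imp_continuous_on ballI DERIV_isCont[OF deriv]) auto
    have "closed S"
      unfolding S_def by (intro continuous_on_closed_Collect_le cont continuous_on_const) simp
    moreover have bdd: "bdd_below S"
      unfolding S_def by (rule bdd_belowI[of _ 0]) auto
    ultimately have T: "Inf S \<in> S"
      using \<open>S \<noteq> {}\<close> by (intro closed_contains_Inf)
    \<comment> \<open>\<open>T\<close> is the first time at which the cone is left; it is attained
      because \<open>S\<close> is closed.\<close>
    define T where "T = Inf S"
    have T01: "0 \<le> T" "T \<le> 1" "\<phi> T \<le> 0"
      using T by (auto simp: S_def T_def)
    have pos: "\<phi> t > 0" if "0 \<le> t" "t < T" for t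
    proof (rule ccontr)
      assume "\<not> \<phi> t > 0"
      hence "t \<in> S" using that T01 by (auto simp: S_def)
      hence "T \<le> t" unfolding T_def by (rule cInf_lower[OF _ bdd])
      thus False using that by simp
    qed
    have "\<phi> 0 > 0" using start \<phi>_iff by simp
    hence "T > 0" using T01 by (cases "T = 0") auto
    \<comment> \<open>The comparison starts at \<open>T / 2\<close> and not at 0, where the factor
      \<open>t ^ m\<close> may vanish and the positivity of \<open>\<phi>\<close> would be
      lost.\<close>
    have "(T / 2) ^ m * \<phi> (T / 2) \<le> T ^ m * \<phi> T"
    proof (rule DERIV_nonneg_imp_increasing_open[where f = "\<lambda>t. t ^ m * \<phi> t"])
      fix t assume t: "T / 2 < t" "t < T"
      hence t': "0 < t" "t \<le> 1" using \<open>T > 0\<close> T01 by auto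
      have "((\<lambda>t. t ^ m * \<phi> t) has_real_derivative
          real m * t ^ (m - 1) * \<phi> t + t ^ m * \<phi>' t) (at t)"
        using t' by (auto intro!: derivative_eq_intros deriv)
      moreover have "0 \<le> real m * t ^ (m - 1) * \<phi> t + t ^ m * \<phi>' t"
      proof -
        have "t * (real m * t ^ (m - 1) * \<phi> t + t ^ m * \<phi>' t) = t ^ m * (t * \<phi>' t + real m * \<phi> t)"
          by (cases m) (auto simp: algebra_simps)
        moreover have "0 \<le> t ^ m * (t * \<phi>' t + real m * \<phi> t)"
          using t t' step'[of t] pos[of t] by (intro mult_nonneg_nonneg) auto
        ultimately show ?thesis
          using t' by (metis zero_le_mult_iff not_less)
      qed
      ultimately show "\<exists>y. ((\<lambda>t. t ^ m * \<phi> t) has_real_derivative y) (at t) \<and> 0 \<le> y"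
        by blast
    next
      show "continuous_on {T / 2..T} (\<lambda>t. t ^ m * \<phi> t)"
        using \<open>T > 0\<close> T01
        by (intro continuous_intros continuous_on_subset[OF cont]) auto
    qed (use \<open>T > 0\<close> in auto)
    moreover have "(T / 2) ^ m * \<phi> (T / 2) > 0"
      using \<open>T > 0\<close> pos[of "T / 2"] by simp
    moreover have "T ^ m * \<phi> T \<le> 0"
      using \<open>T > 0\<close> T01 by (intro mult_nonneg_nonpos) auto
    ultimately show False by simp
  qed
  hence "\<not> \<phi> t \<le> 0"
    using t by (auto simp: S_def)
  thus ?thesis
    using \<phi>_iff[of t] by simp
qed

text \<open>
  If \<open>y x = x powr p * bessel_entire p x\<close>, then \<open>x * y' x = x powr p * bessel_theta p x\<close>.
\<close>

definition bessel_theta :: "complex \<Rightarrow> complex \<Rightarrow> complex" where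
  "bessel_theta p x = p * bessel_entire p x - 2 * (x / 2)\<^sup>2 * bessel_entire (p + 1) x"

section \<open>Bessel's equation and its invariant cone\<close>

lemma bessel_entire_has_field_derivative [derivative_intros]:
  assumes "(g has_field_derivative g') (at x within A)"
  shows "((\<lambda>x. bessel_entire p (g x)) has_field_derivative
           - bessel_entire (p + 1) (g x) * (g x * g' / 2)) (at x within A)"
  unfolding bessel_entire_eq
  by (auto intro!: derivative_eq_intros assms simp: power2_eq_square)

lemma bessel_entire_recurrence:
  "bessel_entire p x = (p + 1) * bessel_entire (p + 1) x - (x / 2)\<^sup>2 * bessel_entire (p + 2) x"
  unfolding bessel_entire_eq by (rule bessel_clifford_recurrence)

text \<open>This is Bessel's equation as a first-order system for the Euler operator. Stating
  \<open>z * e'\<close> and \<open>z * d'\<close> instead of the derivatives keeps it valid at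
  \<open>z = 0\<close>, where the rays start.\<close>

lemma bessel_entire_system:
  obtains e' d' where
    "((\<lambda>z. bessel_entire p (w * z)) has_field_derivative e') (at z)"
    "((\<lambda>z. bessel_theta p (w * z)) has_field_derivative d') (at z)"
    "z * e' = bessel_theta p (w * z) - p * bessel_entire p (w * z)"
    "z * d' = (p\<^sup>2 - (w * z)\<^sup>2) * bessel_entire p (w * z) - p * bessel_theta p (w * z)"
proof
  let ?x = "w * z"
  let ?e = "\<lambda>i. bessel_entire (p + i) ?x"
  show "((\<lambda>z. bessel_entire p (w * z)) has_field_derivative - ?e 1 * (?x * w / 2)) (at z)"
    by (auto intro!: derivative_eq_intros)
  show "((\<lambda>z. bessel_theta p (w * z)) has_field_derivative
      p * (- ?e 1 * (?x * w / 2)) - (?x * w * ?e 1 - ?x\<^sup>2 / 2 * ?e 2 * (?x * w / 2))) (at z)"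
    unfolding bessel_theta_def
    by (auto intro!: derivative_eq_intros simp: power2_eq_square add.assoc) (simp add: field_simps)
  show "z * (- ?e 1 * (?x * w / 2)) = bessel_theta p ?x - p * bessel_entire p ?x"
    by (simp add: bessel_theta_def power2_eq_square)
  \<comment> \<open>The term of order \<open>p + 2\<close>, produced by differentiating
    \<open>bessel_theta\<close>, is eliminated here.\<close>
  have rec: "?x\<^sup>2 * ?e 2 = 4 * (p + 1) * ?e 1 - 4 * bessel_entire p ?x"
    using bessel_entire_recurrence[of p ?x] by (simp add: power_divide field_simps)
  have "z * (p * (- ?e 1 * (?x * w / 2)) - (?x * w * ?e 1 - ?x\<^sup>2 / 2 * ?e 2 * (?x * w / 2))) =
      - p * ?e 1 * ?x\<^sup>2 / 2 - ?x\<^sup>2 * ?e 1 + ?x\<^sup>2 / 4 * (?x\<^sup>2 * ?e 2)"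
    by (simp add: power2_eq_square algebra_simps)
  also have "\<dots> = (p\<^sup>2 - ?x\<^sup>2) * bessel_entire p ?x - p * bessel_theta p ?x"
    unfolding rec by (simp add: bessel_theta_def power_divide algebra_simps power2_eq_square)
  finally show "z * (p * (- ?e 1 * (?x * w / 2)) - (?x * w * ?e 1 - ?x\<^sup>2 / 2 * ?e 2 * (?x * w / 2))) =
      (p\<^sup>2 - ?x\<^sup>2) * bessel_entire p ?x - p * bessel_theta p ?x" .
qed

text \<open>The diagonal terms contribute \<open>n * Re r * (\<epsilon>\<^sup>2 * (norm X)\<^sup>2 +
  (norm Y)\<^sup>2)\<close>. The terms with \<open>Re p\<close> form a multiple of the cone function
  and are absorbed by \<open>m\<close>. The error terms are of order
  \<open>k * (norm X)\<^sup>2 / \<rho>\<close>, because inside the cone \<open>norm e\<close> is at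
  most \<open>norm X / \<rho>\<close>.\<close>

lemma cone_step:
  fixes X Y e r \<kappa>\<^sub>1 \<kappa>\<^sub>2 p :: complex
  assumes e: "2 * r * e = X - Y" and \<rho>: "0 < \<rho>" "\<rho> \<le> Re r"
    and cone: "norm Y \<le> \<epsilon> * norm X" and \<epsilon>: "0 < \<epsilon>" "\<epsilon> \<le> 1"
    and \<kappa>: "norm \<kappa>\<^sub>1 \<le> k" "norm \<kappa>\<^sub>2 \<le> k"
    and n: "2 * k \<le> \<epsilon> * \<rho>\<^sup>2 * n" and m: "2 * Re p \<le> m"
  shows "0 \<le> 2 * (\<epsilon>\<^sup>2 * inner X ((of_real n * r - p) * X + \<kappa>\<^sub>1 * e) -
                   inner Y (- (of_real n * r + p) * Y + \<kappa>\<^sub>2 * e)) +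
      m * (\<epsilon>\<^sup>2 * (norm X)\<^sup>2 - (norm Y)\<^sup>2)"
proof -
  define x y where "x = norm X" and "y = norm Y"
  have xy: "0 \<le> x" "0 \<le> y" "y \<le> \<epsilon> * x"
    using cone by (auto simp: x_def y_def)
  have k: "0 \<le> k" using \<kappa>(1) norm_ge_zero order_trans by blast
  have n0: "0 \<le> n"
  proof (rule ccontr)
    assume "\<not> 0 \<le> n"
    hence "\<epsilon> * \<rho>\<^sup>2 * n < 0" using \<epsilon> \<rho> by (intro mult_pos_neg) auto
    thus False using n k by simp
  qed
  have e_le: "norm e \<le> x / \<rho>"
  proof -
    have "\<rho> \<le> norm r" using \<rho> complex_Re_le_cmod[of r] by linarith
    hence "2 * \<rho> * norm e \<le> 2 * norm r * norm e" by (intro mult_right_mono) auto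
    also have "\<dots> = norm (X - Y)" unfolding e[symmetric] by (simp add: norm_mult)
    also have "\<dots> \<le> x + y" unfolding x_def y_def by (rule norm_triangle_ineq4)
    also have "y \<le> 1 * x" using xy \<epsilon> mult_right_mono[of \<epsilon> 1 x] by linarith
    finally have "\<rho> * norm e \<le> x" by simp
    thus ?thesis using \<rho> by (simp add: field_simps)
  qed
  have inner_self: "inner Z (c * Z) = Re c * (norm Z)\<^sup>2" for Z c :: complex
    unfolding cmod_power2 by (simp add: inner_complex_def power2_eq_square algebra_simps)
  have inner_e: "\<bar>inner Z (c * e)\<bar> \<le> norm Z * (k * (x / \<rho>))" if "norm c \<le> k" for Z c
  proof -
    have "\<bar>inner Z (c * e)\<bar> \<le> norm Z * norm (c * e)" by (rule Cauchy_Schwarz_ineq2)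
    also have "norm (c * e) \<le> k * (x / \<rho>)"
      unfolding norm_mult using that e_le k by (intro mult_mono) auto
    finally show ?thesis by (simp add: mult_left_mono)
  qed
  have "y\<^sup>2 \<le> (\<epsilon> * x)\<^sup>2" using xy by (intro power_mono)
  hence y2: "y\<^sup>2 \<le> \<epsilon>\<^sup>2 * x\<^sup>2" by (simp add: power_mult_distrib)
  have "inner X ((of_real n * r - p) * X + \<kappa>\<^sub>1 * e) \<ge> (n * Re r - Re p) * x\<^sup>2 - x * (k * (x / \<rho>))"
    using inner_e[OF \<kappa>(1), of X] by (simp add: inner_add_right inner_self x_def)
  hence 1: "\<epsilon>\<^sup>2 * inner X ((of_real n * r - p) * X + \<kappa>\<^sub>1 * e) \<ge>
      \<epsilon>\<^sup>2 * ((n * Re r - Re p) * x\<^sup>2 - x * (k * (x / \<rho>)))"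
    by (rule mult_left_mono) simp
  have 2: "inner Y (- (of_real n * r + p) * Y + \<kappa>\<^sub>2 * e) \<le> - (n * Re r + Re p) * y\<^sup>2 + y * (k * (x / \<rho>))"
    using inner_e[OF \<kappa>(2), of Y] by (simp add: inner_add_right inner_self y_def del: mult_minus_left)
  have 3: "y * (k * (x / \<rho>)) \<le> (\<epsilon> * x) * (k * (x / \<rho>))"
    using xy k \<rho> by (intro mult_right_mono) auto
  have 4: "(m - 2 * Re p) * (\<epsilon>\<^sup>2 * x\<^sup>2 - y\<^sup>2) \<ge> 0"
    using m y2 by (intro mult_nonneg_nonneg) auto
  have 5: "n * Re r * y\<^sup>2 \<ge> 0"
    using n0 \<rho> by simp
  have 6: "n * Re r * (\<epsilon>\<^sup>2 * x\<^sup>2) \<ge> n * \<rho> * (\<epsilon>\<^sup>2 * x\<^sup>2)"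
    using n0 \<rho> by (intro mult_right_mono mult_left_mono) auto
  \<comment> \<open>Divided by \<open>\<epsilon> * x\<^sup>2 / \<rho>\<close>, this reads
    \<open>\<epsilon> * k + k \<le> \<epsilon> * \<rho>\<^sup>2 * n\<close>; that is the largeness
    of \<open>n\<close>, as \<open>\<epsilon> \<le> 1\<close>.\<close>
  have 7: "n * \<rho> * (\<epsilon>\<^sup>2 * x\<^sup>2) \<ge> \<epsilon>\<^sup>2 * (x * (k * (x / \<rho>))) + (\<epsilon> * x) * (k * (x / \<rho>))"
  proof -
    have "\<epsilon>\<^sup>2 * (x * (k * (x / \<rho>))) + (\<epsilon> * x) * (k * (x / \<rho>)) = \<epsilon> * (x\<^sup>2 / \<rho>) * (\<epsilon> * k + k)"
      by (simp add: power2_eq_square algebra_simps add_divide_distrib)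
    also have "\<dots> \<le> \<epsilon> * (x\<^sup>2 / \<rho>) * (\<epsilon> * \<rho>\<^sup>2 * n)"
      using n k \<epsilon> mult_right_mono[OF \<epsilon>(2) k] \<rho> by (intro mult_left_mono) auto
    also have "\<dots> = n * \<rho> * (\<epsilon>\<^sup>2 * x\<^sup>2)"
      using \<rho> by (simp add: power2_eq_square)
    finally show ?thesis .
  qed
  have "0 \<le> 2 * (\<epsilon>\<^sup>2 * ((n * Re r - Re p) * x\<^sup>2 - x * (k * (x / \<rho>))) -
      (- (n * Re r + Re p) * y\<^sup>2 + y * (k * (x / \<rho>)))) + m * (\<epsilon>\<^sup>2 * x\<^sup>2 - y\<^sup>2)"
  proof -
    define K where "K = k * (x / \<rho>)"
    show ?thesis
      using 3 4 5 6 7 unfolding K_def[symmetric] by (simp add: algebra_simps)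
  qed
  moreover have "0 \<le> 2 * (P - Q) + c" if "0 \<le> 2 * (P' - Q') + c" "P' \<le> P" "Q \<le> Q'"
    for P Q P' Q' c :: real
    using that by argo
  ultimately show ?thesis
    using 1 2 unfolding x_def y_def by blast
qed

text \<open>\<open>d + r * e\<close> and \<open>d - r * e\<close> diagonalise the leading part
  \<open>z * e' = n * d\<close>, \<open>z * d' = n * r\<^sup>2 * e\<close> of the system. Two errors
  remain: the defect of the true coefficient from \<open>n * r\<^sup>2\<close>, and the term
  \<open>4 * z\<^sup>2 / r\<close> that comes from differentiating \<open>r\<close>.\<close>

lemma bessel_cone:
  fixes p w z\<^sub>0 :: complex and n :: real
  defines "r \<equiv> \<lambda>z. csqrt (1 - 4 * z\<^sup>2)"
  defines "e \<equiv> \<lambda>z. bessel_entire p (w * z)" and "d \<equiv> \<lambda>z. bessel_theta p (w * z) / of_real n"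
  assumes ray: "\<And>t. 0 \<le> t \<Longrightarrow> t \<le> 1 \<Longrightarrow> 1 - 4 * (of_real t * z\<^sub>0)\<^sup>2 \<notin> \<real>\<^sub>\<le>\<^sub>0"
    and \<rho>: "0 < \<rho>" "\<And>t. 0 \<le> t \<Longrightarrow> t \<le> 1 \<Longrightarrow> \<rho> \<le> Re (r (of_real t * z\<^sub>0))"
    and \<kappa>: "\<And>t z. 0 \<le> t \<Longrightarrow> t \<le> 1 \<Longrightarrow> z = of_real t * z\<^sub>0 \<Longrightarrow>
      norm ((p\<^sup>2 - (w * z)\<^sup>2) / of_real n - of_real n * (r z)\<^sup>2) + norm (4 * z\<^sup>2 / r z) \<le> k"
    and \<epsilon>: "0 < \<epsilon>" "\<epsilon> \<le> 1" and n: "0 < n" "2 * k \<le> \<epsilon> * \<rho>\<^sup>2 * n"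
    and start: "norm (p / of_real n - 1) < \<epsilon> * norm (p / of_real n + 1)" "rGamma (p + 1) \<noteq> 0"
  shows "norm (d z\<^sub>0 - r z\<^sub>0 * e z\<^sub>0) < \<epsilon> * norm (d z\<^sub>0 + r z\<^sub>0 * e z\<^sub>0)"
proof -
  define X Y where "X z = d z + r z * e z" and "Y z = d z - r z * e z" for z
  define \<kappa>0 where "\<kappa>0 z = (p\<^sup>2 - (w * z)\<^sup>2) / of_real n - of_real n * (r z)\<^sup>2" for z
  have n': "complex_of_real n \<noteq> 0" using n by simp
  have "\<exists>X' Y'. (X has_field_derivative X') (at z) \<and> (Y has_field_derivative Y') (at z) \<and>
      z * X' = (of_real n * r z - p) * X z + (\<kappa>0 z - 4 * z\<^sup>2 / r z) * e z \<and>
      z * Y' = - (of_real n * r z + p) * Y z + (\<kappa>0 z + 4 * z\<^sup>2 / r z) * e z"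
    if z: "1 - 4 * z\<^sup>2 \<notin> \<real>\<^sub>\<le>\<^sub>0" for z
  proof -
    obtain e' d' where e': "(e has_field_derivative e') (at z)"
      and d': "((\<lambda>z. bessel_theta p (w * z)) has_field_derivative d') (at z)"
      and ze': "z * e' = of_real n * d z - p * e z"
      and zd': "z * d' = (p\<^sup>2 - (w * z)\<^sup>2) * e z - p * (of_real n * d z)"
      using bessel_entire_system[of p w z] n' unfolding e_def d_def by auto
    have d'': "(d has_field_derivative d' / of_real n) (at z)"
      unfolding d_def by (rule DERIV_cdivide[OF d'])
    have r0: "r z \<noteq> 0" using z by (auto simp: r_def)
    have r': "(r has_field_derivative - 4 * z / r z) (at z)"
      unfolding r_def using z by (auto intro!: derivative_eq_intros)
    have zd'': "z * (d' / of_real n) = (\<kappa>0 z + of_real n * (r z)\<^sup>2) * e z - p * d z"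
      unfolding times_divide_eq_right zd' \<kappa>0_def using n' by (simp add: field_simps)
    have "(X has_field_derivative d' / of_real n + (r z * e' + - 4 * z / r z * e z)) (at z)"
      unfolding X_def by (rule DERIV_add[OF d'' DERIV_mult'[OF r' e']])
    moreover have "(Y has_field_derivative d' / of_real n - (r z * e' + - 4 * z / r z * e z)) (at z)"
      unfolding Y_def by (rule DERIV_diff[OF d'' DERIV_mult'[OF r' e']])
    moreover define q where "q = 4 * z\<^sup>2 / r z"
    have re: "z * (r z * e' + - 4 * z / r z * e z) = r z * (of_real n * d z - p * e z) - q * e z"
    proof -
      have "z * (r z * e' + - 4 * z / r z * e z) = r z * (z * e') - q * e z"
        by (simp add: q_def algebra_simps power2_eq_square)
      thus ?thesis by (simp only: ze')
    qed
    have "z * (d' / of_real n + (r z * e' + - 4 * z / r z * e z)) =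
        (of_real n * r z - p) * X z + (\<kappa>0 z - q) * e z"
      unfolding distrib_left[of z "d' / of_real n"] zd'' re X_def by (simp add: algebra_simps power2_eq_square)
    moreover have "z * (d' / of_real n - (r z * e' + - 4 * z / r z * e z)) =
        - (of_real n * r z + p) * Y z + (\<kappa>0 z + q) * e z"
      unfolding right_diff_distrib[of z "d' / of_real n"] zd'' re Y_def
      by (simp add: algebra_simps power2_eq_square)
    ultimately show ?thesis
      unfolding q_def by blast
  qed
  then obtain X' Y' where X': "(X has_field_derivative X' z) (at z)"
    and Y': "(Y has_field_derivative Y' z) (at z)"
    and zX': "z * X' z = (of_real n * r z - p) * X z + (\<kappa>0 z - 4 * z\<^sup>2 / r z) * e z"
    and zY': "z * Y' z = - (of_real n * r z + p) * Y z + (\<kappa>0 z + 4 * z\<^sup>2 / r z) * e z"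
    if "1 - 4 * z\<^sup>2 \<notin> \<real>\<^sub>\<le>\<^sub>0" for z
    by metis
  have lin: "((\<lambda>t. of_real t * z\<^sub>0) has_vector_derivative z\<^sub>0) (at t)" for t
    by (auto intro!: derivative_eq_intros)
  obtain m :: nat where m: "real m \<ge> 2 * Re p"
    using real_arch_simple by blast
  have "norm (Y (of_real 1 * z\<^sub>0)) < \<epsilon> * norm (X (of_real 1 * z\<^sub>0))"
  proof (rule cone_invariant[where m = m])
    fix t :: real assume t: "0 \<le> t" "t \<le> 1"
    let ?z = "of_real t * z\<^sub>0"
    show "((\<lambda>t. X (of_real t * z\<^sub>0)) has_vector_derivative z\<^sub>0 * X' ?z) (at t)"
      using field_vector_diff_chain_at[OF lin X'[OF ray[OF t]]] by (simp add: o_def)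
    show "((\<lambda>t. Y (of_real t * z\<^sub>0)) has_vector_derivative z\<^sub>0 * Y' ?z) (at t)"
      using field_vector_diff_chain_at[OF lin Y'[OF ray[OF t]]] by (simp add: o_def)
  next
    \<comment> \<open>At the origin \<open>d / e = p / n\<close> and \<open>r = 1\<close>, so the
      initial cone condition is the hypothesis \<open>start\<close> multiplied by the nonzero factor
      \<open>rGamma (p + 1)\<close>.\<close>
    have "r 0 = 1" "e 0 = rGamma (p + 1)" "d 0 = p / of_real n * rGamma (p + 1)"
      by (simp_all add: r_def e_def d_def bessel_theta_def bessel_entire_eq bessel_clifford_0)
    hence "X 0 = (p / of_real n + 1) * rGamma (p + 1)" "Y 0 = (p / of_real n - 1) * rGamma (p + 1)"
      by (simp_all add: X_def Y_def algebra_simps)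
    thus "norm (Y (of_real 0 * z\<^sub>0)) < \<epsilon> * norm (X (of_real 0 * z\<^sub>0))"
      using start by (simp add: norm_mult)
  next
    fix t :: real
    let ?z = "of_real t * z\<^sub>0"
    assume t: "0 < t" "t \<le> 1" and cone: "norm (Y ?z) \<le> \<epsilon> * norm (X ?z)"
    have k: "norm (\<kappa>0 ?z - 4 * ?z\<^sup>2 / r ?z) \<le> k" "norm (\<kappa>0 ?z + 4 * ?z\<^sup>2 / r ?z) \<le> k"
      using \<kappa>[of t ?z] t norm_triangle_ineq[of "\<kappa>0 ?z" "4 * ?z\<^sup>2 / r ?z"]
        norm_triangle_ineq4[of "\<kappa>0 ?z" "4 * ?z\<^sup>2 / r ?z"]
      unfolding \<kappa>0_def by auto
    have "2 * r ?z * e ?z = X ?z - Y ?z" by (simp add: X_def Y_def)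
    from cone_step[OF this \<rho>(1) \<rho>(2) cone \<epsilon> k n(2) m] t
    show "0 \<le> 2 * (\<epsilon>\<^sup>2 * inner (X ?z) (of_real t * (z\<^sub>0 * X' ?z)) -
          inner (Y ?z) (of_real t * (z\<^sub>0 * Y' ?z))) +
        real m * (\<epsilon>\<^sup>2 * (norm (X ?z))\<^sup>2 - (norm (Y ?z))\<^sup>2)"
      unfolding mult.assoc[symmetric, of "of_real t" z\<^sub>0] using zX'[OF ray[of t]] zY'[OF ray[of t]]
      by (simp only: less_imp_le)
  qed (use \<epsilon> in auto)
  thus ?thesis by (simp add: X_def Y_def)
qed

text \<open>With \<open>p = \<mu> + n\<close> and \<open>w = \<sigma> + 2 * n\<close> the
  coefficient \<open>(p\<^sup>2 - (w * z)\<^sup>2) / n\<close> equals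
  \<open>n * (1 - 4 * z\<^sup>2)\<close> up to a bounded error, whence the choice of
  \<open>r\<close>. Compactness makes the constants uniform, and the star shape of \<open>K\<close>
  keeps the rays from the origin inside it.\<close>

lemma bessel_theta_bounds:
  fixes \<mu> \<sigma> :: complex and K :: "complex set"
  assumes "compact K"
    and star: "\<And>z t. z \<in> K \<Longrightarrow> 0 \<le> t \<Longrightarrow> t \<le> 1 \<Longrightarrow> of_real t * z \<in> K"
    and slit: "\<And>z. z \<in> K \<Longrightarrow> 1 - 4 * z\<^sup>2 \<notin> \<real>\<^sub>\<le>\<^sub>0"
  shows "\<exists>\<delta> C N. 0 < \<delta> \<and> (\<forall>n z. n \<ge> N \<longrightarrow> z \<in> K \<longrightarrow>
    (\<exists>u. bessel_theta (\<mu> + of_nat n) ((\<sigma> + 2 * of_nat n) * z) =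
          of_nat n * u * bessel_entire (\<mu> + of_nat n) ((\<sigma> + 2 * of_nat n) * z) \<and>
        bessel_entire (\<mu> + of_nat n) ((\<sigma> + 2 * of_nat n) * z) \<noteq> 0 \<and> \<delta> \<le> Re u \<and> norm u \<le> C))"
proof (cases "K = {}")
  case True
  thus ?thesis by (intro exI[of _ 1]) simp
next
  case False
  define r where "r z = csqrt (1 - 4 * z\<^sup>2)" for z
  have cont: "continuous_on K r"
    unfolding r_def
    by (rule continuous_on_compose2[OF continuous_on_csqrt])
       (use slit in \<open>auto intro!: continuous_intros\<close>)
  have Re_pos: "Re (r z) > 0" if "z \<in> K" for z
  proof -
    \<comment> \<open>A purely imaginary root would have a nonpositive real square, which the slit
      condition excludes.\<close>
    have "Re (r z) \<noteq> 0"
    proof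
      assume "Re (r z) = 0"
      hence A: "(r z)\<^sup>2 = of_real (- (Im (r z))\<^sup>2)"
        by (simp add: complex_eq_iff power2_eq_square)
      have "1 - 4 * z\<^sup>2 = (r z)\<^sup>2" by (simp only: r_def power2_csqrt)
      also note A
      finally have "1 - 4 * z\<^sup>2 = of_real (- (Im (r z))\<^sup>2)" .
      moreover have "complex_of_real (- (Im (r z))\<^sup>2) \<in> \<real>\<^sub>\<le>\<^sub>0"
        unfolding nonpos_Reals_of_real_iff by simp
      ultimately have "1 - 4 * z\<^sup>2 \<in> \<real>\<^sub>\<le>\<^sub>0"
        by (rule ssubst)
      thus False using slit[OF that] by blast
    qed
    moreover have "Re (r z) \<ge> 0" unfolding r_def by (rule Re_csqrt)
    ultimately show ?thesis by linarith
  qed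
  obtain z\<^sub>m where z\<^sub>m: "z\<^sub>m \<in> K" "\<And>z. z \<in> K \<Longrightarrow> Re (r z\<^sub>m) \<le> Re (r z)"
    using continuous_attains_inf[OF \<open>compact K\<close> False continuous_on_Re[OF cont]] by blast
  define \<rho> where "\<rho> = Re (r z\<^sub>m)"
  have \<rho>: "\<rho> > 0" "\<And>z. z \<in> K \<Longrightarrow> \<rho> \<le> Re (r z)"
    using Re_pos z\<^sub>m by (auto simp: \<rho>_def)
  obtain R where R: "\<And>z. z \<in> K \<Longrightarrow> norm (r z) \<le> R"
    using compact_imp_bounded[OF compact_continuous_image[OF cont \<open>compact K\<close>]]
    unfolding bounded_iff by auto
  obtain Z where Z: "\<And>z. z \<in> K \<Longrightarrow> norm z \<le> Z"
    using compact_imp_bounded[OF \<open>compact K\<close>] unfolding bounded_iff by auto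
  have \<rho>_norm: "\<rho> \<le> norm (r z)" if "z \<in> K" for z
    using \<rho>(2)[OF that] complex_Re_le_cmod[of "r z"] by linarith
  have "\<rho> \<le> R" using \<rho>_norm[OF z\<^sub>m(1)] R[OF z\<^sub>m(1)] by linarith
  have "Z \<ge> 0" using Z[OF z\<^sub>m(1)] norm_ge_zero order_trans by blast
  \<comment> \<open>The opening is chosen so that the cone condition forces
    \<open>norm (u - r z) \<le> \<rho> / 2\<close>, which leaves
    \<open>Re u \<ge> \<rho> / 2\<close>.\<close>
  define \<epsilon> where "\<epsilon> = \<rho> / (8 * R)"
  have \<epsilon>: "0 < \<epsilon>" "\<epsilon> \<le> 1 / 8" "8 * \<epsilon> * R = \<rho>"
    using \<rho>(1) \<open>\<rho> \<le> R\<close> by (auto simp: \<epsilon>_def field_simps)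
  \<comment> \<open>\<open>k\<close> bounds the coefficient defect, with \<open>1 / n\<close>
    estimated by 1, together with the term \<open>4 * z\<^sup>2 / r z\<close>.\<close>
  define k where "k = 2 * norm \<mu> + (norm \<mu>)\<^sup>2 + (4 * norm \<sigma> + (norm \<sigma>)\<^sup>2) * Z\<^sup>2 + 4 * Z\<^sup>2 / \<rho>"
  \<comment> \<open>The summands ensure, in this order, \<open>n \<ge> 1\<close>, the cone condition
    at the origin, and the smallness of the errors along the ray.\<close>
  obtain N :: nat where N: "real N \<ge> 1 + norm \<mu> / \<epsilon> + 2 * k / (\<epsilon> * \<rho>\<^sup>2)"
    using real_arch_simple by blast
  have k0: "k \<ge> 0" using \<rho>(1) by (auto simp: k_def intro!: add_nonneg_nonneg mult_nonneg_nonneg)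
  show ?thesis
  proof (rule exI[of _ "\<rho> / 2"], rule exI[of _ "R + \<rho>"], rule exI[of _ N], intro conjI allI impI)
    fix n :: nat and z assume n: "n \<ge> N" and z: "z \<in> K"
    define p w where "p = \<mu> + of_nat n" and "w = \<sigma> + 2 * of_nat n"
    have "1 \<le> real n" "norm \<mu> / \<epsilon> < real n" "2 * k / (\<epsilon> * \<rho>\<^sup>2) \<le> real n"
    proof -
      have "real N \<le> real n" using n by simp
      moreover have "0 \<le> norm \<mu> / \<epsilon>" "0 \<le> 2 * k / (\<epsilon> * \<rho>\<^sup>2)" using \<epsilon> \<rho> k0 by auto
      ultimately show "1 \<le> real n" "norm \<mu> / \<epsilon> < real n" "2 * k / (\<epsilon> * \<rho>\<^sup>2) \<le> real n"
        using N by linarith+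
    qed
    hence n_ge: "1 \<le> real n" "norm \<mu> < \<epsilon> * real n" "2 * k \<le> \<epsilon> * \<rho>\<^sup>2 * real n"
      using \<epsilon> \<rho> by (simp_all add: field_simps)
    have n0: "complex_of_nat n \<noteq> 0" using n_ge by auto
    define e d where "e = bessel_entire p (w * z)" and "d = bessel_theta p (w * z) / of_real (real n)"
    have "norm (d - r z * e) < \<epsilon> * norm (d + r z * e)"
      unfolding e_def d_def r_def
    proof (rule bessel_cone[where \<rho> = \<rho> and k = k])
      fix t :: real assume t: "0 \<le> t" "t \<le> 1"
      show "1 - 4 * (of_real t * z)\<^sup>2 \<notin> \<real>\<^sub>\<le>\<^sub>0"
        by (rule slit[OF star[OF z t]])
      show "\<rho> \<le> Re (csqrt (1 - 4 * (of_real t * z)\<^sup>2))"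
        using \<rho>(2)[OF star[OF z t]] by (simp only: r_def)
      fix y assume "y = of_real t * z"
      hence y: "y \<in> K" using star[OF z t] by simp
      have "(p\<^sup>2 - (w * y)\<^sup>2) / of_real (real n) - of_real (real n) * (csqrt (1 - 4 * y\<^sup>2))\<^sup>2 =
          2 * \<mu> + \<mu>\<^sup>2 / of_nat n - (4 * \<sigma> + \<sigma>\<^sup>2 / of_nat n) * y\<^sup>2"
        unfolding power2_csqrt using n0 by (simp add: p_def w_def field_simps power2_eq_square)
      moreover have "norm (2 * \<mu> + \<mu>\<^sup>2 / of_nat n - (4 * \<sigma> + \<sigma>\<^sup>2 / of_nat n) * y\<^sup>2) \<le>
          2 * norm \<mu> + (norm \<mu>)\<^sup>2 + (4 * norm \<sigma> + (norm \<sigma>)\<^sup>2) * Z\<^sup>2"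
      proof -
        have *: "norm (c * x + x\<^sup>2 / of_nat n) \<le> norm c * norm x + (norm x)\<^sup>2" for c x :: complex
        proof (rule norm_triangle_le, rule add_mono)
          show "norm (c * x) \<le> norm c * norm x" by (simp add: norm_mult)
          have "(norm x)\<^sup>2 / real n \<le> (norm x)\<^sup>2 / 1"
            using n_ge(1) by (intro divide_left_mono) auto
          thus "norm (x\<^sup>2 / of_nat n) \<le> (norm x)\<^sup>2" by (simp add: norm_divide norm_power)
        qed
        have "norm ((4 * \<sigma> + \<sigma>\<^sup>2 / of_nat n) * y\<^sup>2) \<le> (4 * norm \<sigma> + (norm \<sigma>)\<^sup>2) * Z\<^sup>2"
          unfolding norm_mult norm_power using *[of 4 \<sigma>] Z[OF y]
          by (intro mult_mono power_mono) auto
        thus ?thesis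
          using *[of 2 \<mu>]
          by (intro order_trans[OF norm_triangle_ineq4] add_mono) auto
      qed
      moreover have "norm (4 * y\<^sup>2 / csqrt (1 - 4 * y\<^sup>2)) \<le> 4 * Z\<^sup>2 / \<rho>"
        unfolding norm_divide norm_mult norm_power
        using \<rho>_norm[OF y] \<rho>(1) Z[OF y]
        by (intro frac_le mult_mono power_mono) (auto simp: r_def)
      ultimately show "norm ((p\<^sup>2 - (w * y)\<^sup>2) / of_real (real n) -
          of_real (real n) * (csqrt (1 - 4 * y\<^sup>2))\<^sup>2) + norm (4 * y\<^sup>2 / csqrt (1 - 4 * y\<^sup>2)) \<le> k"
        by (simp add: k_def)
    next
      have "norm (\<mu> / of_nat n) < \<epsilon>"
        using n_ge by (simp add: norm_divide field_simps)
      moreover have "\<epsilon> * 1 \<le> \<epsilon> * norm (2 + \<mu> / of_nat n)"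
      proof (rule mult_left_mono)
        have "norm (2 :: complex) - norm (\<mu> / of_nat n) \<le> norm (2 + \<mu> / of_nat n)"
          by (rule norm_diff_ineq)
        thus "1 \<le> norm (2 + \<mu> / of_nat n)"
          using \<open>norm (\<mu> / of_nat n) < \<epsilon>\<close> \<epsilon> by simp
      qed (use \<epsilon> in auto)
      moreover have "p / of_nat n - 1 = \<mu> / of_nat n" "p / of_nat n + 1 = 2 + \<mu> / of_nat n"
        using n0 by (simp_all add: p_def field_simps)
      ultimately show "norm (p / of_real (real n) - 1) < \<epsilon> * norm (p / of_real (real n) + 1)"
        by simp
    next
      have "norm \<mu> < real n" using n_ge \<epsilon> mult_right_mono[of \<epsilon> 1 "real n"] by linarith
      hence "Re p > 0"
        using abs_Re_le_cmod[of \<mu>] by (simp add: p_def)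
      hence "p + 1 \<notin> \<int>\<^sub>\<le>\<^sub>0"
        by (auto elim!: nonpos_Ints_cases simp: complex_eq_iff)
      thus "rGamma (p + 1) \<noteq> 0" by (simp add: rGamma_eq_zero_iff)
    qed (use \<epsilon> \<rho> n_ge in auto)
    hence cone: "norm (d - r z * e) < \<epsilon> * norm (d + r z * e)" .
    \<comment> \<open>At a zero of \<open>e\<close> the two combinations \<open>d + r * e\<close>
      and \<open>d - r * e\<close> would coincide, which a cone with \<open>\<epsilon> < 1\<close>
      forbids.\<close>
    have e0: "e \<noteq> 0"
    proof
      assume "e = 0"
      hence "norm d < \<epsilon> * norm d" using cone by simp
      moreover have "\<epsilon> * norm d \<le> 1 * norm d" using \<epsilon> by (intro mult_right_mono) auto
      ultimately show False by simp
    qed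
    define u where "u = d / e"
    have "norm (u - r z) * norm e < \<epsilon> * norm (u + r z) * norm e"
      using cone e0 by (simp add: u_def algebra_simps flip: norm_mult)
    hence "norm (u - r z) < \<epsilon> * norm (u + r z)"
      using e0 by simp
    also have "u + r z = (u - r z) + 2 * r z" by simp
    also have "norm \<dots> \<le> norm (u - r z) + 2 * R"
      using R[OF z] by (intro norm_triangle_mono) (auto simp: norm_mult)
    finally have "norm (u - r z) \<le> \<epsilon> * norm (u - r z) + 2 * \<epsilon> * R"
      using \<epsilon> by (simp add: algebra_simps)
    moreover have "\<epsilon> * norm (u - r z) \<le> 1 / 8 * norm (u - r z)"
      using \<epsilon> by (intro mult_right_mono) auto
    moreover have "2 * \<epsilon> * R = \<rho> / 4" using \<epsilon>(3) by simp
    ultimately have ur: "norm (u - r z) \<le> \<rho> / 2"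
      using \<rho>(1) by linarith
    have "Re (r z - u) \<le> norm (u - r z)"
      using complex_Re_le_cmod[of "r z - u"] by (simp add: norm_minus_commute)
    hence "\<rho> / 2 \<le> Re u"
      using ur \<rho>(2)[OF z] by simp
    moreover have "norm u \<le> R + \<rho>"
      using norm_triangle_ineq[of "u - r z" "r z"] R[OF z] ur \<rho>(1) by simp
    moreover have "bessel_theta p (w * z) = of_nat n * u * e"
      using e0 n0 by (simp add: u_def d_def)
    ultimately show "\<exists>u. bessel_theta (\<mu> + of_nat n) ((\<sigma> + 2 * of_nat n) * z) =
          of_nat n * u * bessel_entire (\<mu> + of_nat n) ((\<sigma> + 2 * of_nat n) * z) \<and>
        bessel_entire (\<mu> + of_nat n) ((\<sigma> + 2 * of_nat n) * z) \<noteq> 0 \<and> \<rho> / 2 \<le> Re u \<and> norm u \<le> R + \<rho>"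
      using e0 unfolding e_def p_def w_def by blast
  qed (use \<rho> in auto)
qed

text \<open>Up to a constant factor, this is the \<open>n\<close>-th Bessel product divided by \<open>z\<close> to the power \<open>\<mu> + \<nu>\<close>.\<close>

definition kapteyn_term :: "complex \<Rightarrow> complex \<Rightarrow> nat \<Rightarrow> complex \<Rightarrow> complex" where
  "kapteyn_term \<mu> \<nu> n z = z ^ (2 * n) *
     bessel_entire (\<mu> + of_nat n) ((\<mu> + \<nu> + 2 * of_nat n) * z) *
     bessel_entire (\<nu> + of_nat n) ((\<mu> + \<nu> + 2 * of_nat n) * z)"

section \<open>Logarithmic derivatives and growth of the Kapteyn terms\<close>

lemma kapteyn_term_deriv_bounds:
  fixes \<mu> \<nu> :: complex and K :: "complex set"
  assumes K: "compact K" "\<And>z t. z \<in> K \<Longrightarrow> 0 \<le> t \<Longrightarrow> t \<le> 1 \<Longrightarrow> of_real t * z \<in> K"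
    "\<And>z. z \<in> K \<Longrightarrow> 1 - 4 * z\<^sup>2 \<notin> \<real>\<^sub>\<le>\<^sub>0"
  obtains \<delta> C N v where "0 < \<delta>"
    "\<And>n z. n \<ge> N \<Longrightarrow> z \<in> K \<Longrightarrow> z \<noteq> 0 \<Longrightarrow>
      (kapteyn_term \<mu> \<nu> n has_field_derivative v n z / z * kapteyn_term \<mu> \<nu> n z) (at z)"
    "\<And>n z. n \<ge> N \<Longrightarrow> z \<in> K \<Longrightarrow> \<delta> * real n \<le> Re (v n z)"
    "\<And>n z. n \<ge> N \<Longrightarrow> z \<in> K \<Longrightarrow> norm (v n z) \<le> C * real n"
proof -
  define \<sigma> where "\<sigma> = \<mu> + \<nu>"
  define E where "E p n z = bessel_entire (p + of_nat n) ((\<sigma> + 2 * of_nat n) * z)" for p n z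
  define \<theta> where "\<theta> p n z = bessel_theta (p + of_nat n) ((\<sigma> + 2 * of_nat n) * z) / E p n z" for p n z
  have *: "\<exists>\<delta> C N. 0 < \<delta> \<and> (\<forall>n z. n \<ge> N \<longrightarrow> z \<in> K \<longrightarrow>
      E p n z \<noteq> 0 \<and> \<delta> * real n \<le> Re (\<theta> p n z) \<and> norm (\<theta> p n z) \<le> C * real n)" for p
  proof -
    obtain \<delta> C N where b: "0 < \<delta>" "\<And>n z. n \<ge> N \<Longrightarrow> z \<in> K \<Longrightarrow>
      \<exists>u. bessel_theta (p + of_nat n) ((\<sigma> + 2 * of_nat n) * z) = of_nat n * u * E p n z \<and>
        E p n z \<noteq> 0 \<and> \<delta> \<le> Re u \<and> norm u \<le> C"
      using bessel_theta_bounds[of K p \<sigma>] K unfolding E_def by blast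
    have "E p n z \<noteq> 0 \<and> \<delta> * real n \<le> Re (\<theta> p n z) \<and> norm (\<theta> p n z) \<le> C * real n"
      if nz: "n \<ge> N" "z \<in> K" for n z
    proof -
      obtain u where u: "bessel_theta (p + of_nat n) ((\<sigma> + 2 * of_nat n) * z) = of_nat n * u * E p n z"
        "E p n z \<noteq> 0" "\<delta> \<le> Re u" "norm u \<le> C"
        using b(2)[OF nz] by blast
      have "\<theta> p n z = of_nat n * u" unfolding \<theta>_def u(1) using u(2) by simp
      hence "Re (\<theta> p n z) = Re u * real n" "norm (\<theta> p n z) = norm u * real n"
        by (simp_all add: norm_mult)
      thus ?thesis
        using u(2) mult_right_mono[OF u(3), of "real n"] mult_right_mono[OF u(4), of "real n"]
        by auto
    qed
    thus ?thesis using b(1) by blast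
  qed
  obtain \<delta>\<^sub>1 C\<^sub>1 N\<^sub>1 where 1: "0 < \<delta>\<^sub>1" "\<And>n z. n \<ge> N\<^sub>1 \<Longrightarrow> z \<in> K \<Longrightarrow>
      E \<mu> n z \<noteq> 0 \<and> \<delta>\<^sub>1 * real n \<le> Re (\<theta> \<mu> n z) \<and> norm (\<theta> \<mu> n z) \<le> C\<^sub>1 * real n"
    using *[of \<mu>] by blast
  obtain \<delta>\<^sub>2 C\<^sub>2 N\<^sub>2 where 2: "0 < \<delta>\<^sub>2" "\<And>n z. n \<ge> N\<^sub>2 \<Longrightarrow> z \<in> K \<Longrightarrow>
      E \<nu> n z \<noteq> 0 \<and> \<delta>\<^sub>2 * real n \<le> Re (\<theta> \<nu> n z) \<and> norm (\<theta> \<nu> n z) \<le> C\<^sub>2 * real n"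
    using *[of \<nu>] by blast
  \<comment> \<open>From \<open>N\<^sub>3\<close> on, \<open>norm \<sigma>\<close> is dominated both
    by \<open>\<delta>\<^sub>2 * n\<close>, the lower bound for the second factor, and by
    \<open>n\<close>. This leaves \<open>\<delta>\<^sub>1\<close> as lower and
    \<open>C\<^sub>1 + C\<^sub>2 + 1\<close> as upper constant.\<close>
  obtain N\<^sub>3 :: nat where N\<^sub>3: "norm \<sigma> / \<delta>\<^sub>2 + norm \<sigma> \<le> real N\<^sub>3"
    using real_arch_simple by blast
  define N where "N = max N\<^sub>1 (max N\<^sub>2 N\<^sub>3)"
  have \<sigma>_le: "norm \<sigma> \<le> \<delta>\<^sub>2 * real n" "norm \<sigma> \<le> real n" if "n \<ge> N" for n
  proof -
    have "real N\<^sub>3 \<le> real n" using that by (simp add: N_def)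
    moreover have "0 \<le> norm \<sigma> / \<delta>\<^sub>2" "0 \<le> norm \<sigma>" using 2(1) by auto
    ultimately have "norm \<sigma> / \<delta>\<^sub>2 \<le> real n" "norm \<sigma> \<le> real n"
      using N\<^sub>3 by linarith+
    thus "norm \<sigma> \<le> \<delta>\<^sub>2 * real n" "norm \<sigma> \<le> real n"
      using 2(1) by (simp_all add: field_simps)
  qed
  show ?thesis
  \<comment> \<open>In \<open>z\<close> times the logarithmic derivative, the \<open>2 * n\<close>
    from \<open>z ^ (2 * n)\<close> cancels the two terms \<open>- n\<close> that come from the
    orders \<open>\<mu> + n\<close> and \<open>\<nu> + n\<close>; only \<open>- \<sigma>\<close> is
    left beside the two quotients \<open>\<theta>\<close>.\<close>
  proof (rule that[of \<delta>\<^sub>1 N "\<lambda>n z. \<theta> \<mu> n z + \<theta> \<nu> n z - \<sigma>" "C\<^sub>1 + C\<^sub>2 + 1"])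
    fix n z assume n: "n \<ge> N" and z: "z \<in> K"
    have E0: "E \<mu> n z \<noteq> 0" "E \<nu> n z \<noteq> 0"
      and b: "\<delta>\<^sub>1 * real n \<le> Re (\<theta> \<mu> n z)" "norm (\<theta> \<mu> n z) \<le> C\<^sub>1 * real n"
        "\<delta>\<^sub>2 * real n \<le> Re (\<theta> \<nu> n z)" "norm (\<theta> \<nu> n z) \<le> C\<^sub>2 * real n"
      using 1(2)[of n z] 2(2)[of n z] n z by (auto simp: N_def)
    show "\<delta>\<^sub>1 * real n \<le> Re (\<theta> \<mu> n z + \<theta> \<nu> n z - \<sigma>)"
      using b(1,3) \<sigma>_le[OF n] complex_Re_le_cmod[of \<sigma>] by simp
    show "norm (\<theta> \<mu> n z + \<theta> \<nu> n z - \<sigma>) \<le> (C\<^sub>1 + C\<^sub>2 + 1) * real n"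
      using b(2,4) \<sigma>_le(2)[OF n] norm_triangle_ineq4[of "\<theta> \<mu> n z + \<theta> \<nu> n z" \<sigma>]
        norm_triangle_ineq[of "\<theta> \<mu> n z" "\<theta> \<nu> n z"] by (simp add: algebra_simps)
    assume z0: "z \<noteq> 0"
    have E': "(E p n has_field_derivative (\<theta> p n z - (p + of_nat n)) / z * E p n z) (at z)"
      if "E p n z \<noteq> 0" for p
    proof -
      obtain e' where e': "((\<lambda>z. bessel_entire (p + of_nat n) ((\<sigma> + 2 * of_nat n) * z))
          has_field_derivative e') (at z)"
        and ze': "z * e' = bessel_theta (p + of_nat n) ((\<sigma> + 2 * of_nat n) * z) - (p + of_nat n) * E p n z"
        unfolding E_def by (rule bessel_entire_system)
      have "bessel_theta (p + of_nat n) ((\<sigma> + 2 * of_nat n) * z) = \<theta> p n z * E p n z"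
        using that by (simp add: \<theta>_def)
      with ze' have "z * e' = (\<theta> p n z - (p + of_nat n)) * E p n z"
        by (simp only: left_diff_distrib)
      hence "z * e' / z = (\<theta> p n z - (p + of_nat n)) / z * E p n z"
        by (simp only: times_divide_eq_left)
      hence "e' = (\<theta> p n z - (p + of_nat n)) / z * E p n z"
        using z0 by simp
      with e' show ?thesis by (simp only: E_def[abs_def])
    qed
    have "((\<lambda>z. z ^ (2 * n)) has_field_derivative of_nat (2 * n) / z * z ^ (2 * n)) (at z)"
    proof (rule DERIV_cong)
      show "((\<lambda>z. z ^ (2 * n)) has_field_derivative of_nat (2 * n) * z ^ (2 * n - Suc 0)) (at z)"
        by (auto intro!: derivative_eq_intros)
      have "z ^ (2 * n) = z ^ (2 * n - Suc 0) * z" if "n > 0"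
        using power_minus_mult[of "2 * n" z] that by simp
      thus "of_nat (2 * n) * z ^ (2 * n - Suc 0) = of_nat (2 * n) / z * z ^ (2 * n)"
        using z0 by (cases "n = 0") auto
    qed
    from DERIV_mult'[OF DERIV_mult'[OF this E'[OF E0(1)]] E'[OF E0(2)]]
    show "(kapteyn_term \<mu> \<nu> n has_field_derivative
        (\<theta> \<mu> n z + \<theta> \<nu> n z - \<sigma>) / z * kapteyn_term \<mu> \<nu> n z) (at z)"
      unfolding kapteyn_term_def[abs_def] \<sigma>_def[symmetric] E_def[symmetric]
      by (rule DERIV_cong) (simp add: divide_inverse algebra_simps \<sigma>_def)
  qed (use 1 in auto)
qed

lemma kapteyn_term_field_differentiable: "kapteyn_term \<mu> \<nu> n field_differentiable at z"
proof -
  have "(\<lambda>z. bessel_entire p (w * z)) field_differentiable at z" for p w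
    using bessel_entire_system[of p w z] unfolding field_differentiable_def by metis
  thus ?thesis
    unfolding kapteyn_term_def[abs_def]
    by (intro field_differentiable_mult) (auto simp: field_differentiable_def intro!: derivative_eq_intros exI)
qed

text \<open>Both estimates integrate the logarithmic derivative. Radially its real part is at least
  \<open>\<delta> * n / t\<close>, which yields a power of \<open>t\<close>; on a segment outside
  the ball of radius \<open>\<rho>\<close> its norm is at most \<open>C * n / \<rho>\<close>. The
  second estimate compares neighbouring points on different rays.\<close>

lemma kapteyn_term_growth:
  fixes \<mu> \<nu> :: complex and K :: "complex set"
  assumes K: "compact K" "\<And>z t. z \<in> K \<Longrightarrow> 0 \<le> t \<Longrightarrow> t \<le> 1 \<Longrightarrow> of_real t * z \<in> K"
    "\<And>z. z \<in> K \<Longrightarrow> 1 - 4 * z\<^sup>2 \<notin> \<real>\<^sub>\<le>\<^sub>0"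
  obtains \<delta> C N where "0 < \<delta>" "0 < C"
    "\<And>n z t. n \<ge> N \<Longrightarrow> z \<in> K \<Longrightarrow> z \<noteq> 0 \<Longrightarrow> 0 < t \<Longrightarrow> t \<le> 1 \<Longrightarrow>
      norm (kapteyn_term \<mu> \<nu> n (of_real t * z)) \<le> t powr (\<delta> * real n) * norm (kapteyn_term \<mu> \<nu> n z)"
    "\<And>n y z \<rho>. n \<ge> N \<Longrightarrow> 0 < \<rho> \<Longrightarrow> closed_segment y z \<subseteq> K - ball 0 \<rho> \<Longrightarrow>
      norm (kapteyn_term \<mu> \<nu> n y) \<le> exp (C * real n * norm (z - y) / \<rho>) * norm (kapteyn_term \<mu> \<nu> n z)"
proof -
  obtain \<delta> C N v where "0 < \<delta>" and v: "\<And>n z. n \<ge> N \<Longrightarrow> z \<in> K \<Longrightarrow> z \<noteq> 0 \<Longrightarrow>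
      (kapteyn_term \<mu> \<nu> n has_field_derivative v n z / z * kapteyn_term \<mu> \<nu> n z) (at z)"
    "\<And>n z. n \<ge> N \<Longrightarrow> z \<in> K \<Longrightarrow> \<delta> * real n \<le> Re (v n z)"
    "\<And>n z. n \<ge> N \<Longrightarrow> z \<in> K \<Longrightarrow> norm (v n z) \<le> C * real n"
    by (rule kapteyn_term_deriv_bounds[of K \<mu> \<nu>]) (use K in auto)
  have C: "norm (v n z) \<le> (\<bar>C\<bar> + 1) * real n" if "n \<ge> N" "z \<in> K" for n z
    by (rule order_trans[OF v(3)[OF that]], rule mult_right_mono) auto
  show ?thesis
  proof (rule that[of \<delta> "\<bar>C\<bar> + 1" N])
    fix n z and t :: real
    assume n: "n \<ge> N" and z: "z \<in> K" "z \<noteq> 0" and t: "0 < t" "t \<le> 1"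
    let ?F = "\<lambda>s. kapteyn_term \<mu> \<nu> n (of_real s * z)"
    have "norm (?F t) \<le> exp (\<delta> * real n * ln t - \<delta> * real n * ln 1) * norm (?F 1)"
    proof (rule norm_growth[where \<gamma>' = "\<lambda>s. \<delta> * real n / s" and g = "\<lambda>s. v n (of_real s * z) / of_real s"])
      fix s :: real assume "t \<le> s" "s \<le> 1"
      hence s: "0 < s" "s \<le> 1" using t by auto
      have sz: "of_real s * z \<in> K" "of_real s * z \<noteq> 0" using K(2)[OF z(1), of s] s z by auto
      have "((\<lambda>s. of_real s * z) has_vector_derivative z) (at s)"
        by (auto intro!: derivative_eq_intros)
      from field_vector_diff_chain_at[OF this v(1)[OF n sz]]
      show "(?F has_vector_derivative v n (of_real s * z) / of_real s * ?F s) (at s)"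
        using z(2) by (simp add: o_def)
      show "((\<lambda>t. \<delta> * real n * ln t) has_real_derivative \<delta> * real n / s) (at s)"
        using s by (auto intro!: derivative_eq_intros)
      show "\<delta> * real n / s \<le> Re (v n (of_real s * z) / of_real s)"
        using v(2)[OF n sz(1)] s by (simp add: divide_right_mono)
    qed (use t in auto)
    thus "norm (kapteyn_term \<mu> \<nu> n (of_real t * z)) \<le> t powr (\<delta> * real n) * norm (kapteyn_term \<mu> \<nu> n z)"
      using t by (simp add: powr_def)
  next
    fix n y z and \<rho> :: real
    assume n: "n \<ge> N" and \<rho>: "0 < \<rho>" and seg: "closed_segment y z \<subseteq> K - ball 0 \<rho>"
    define \<Lambda> where "\<Lambda> = (\<bar>C\<bar> + 1) * real n * norm (z - y) / \<rho>"
    define l where "l s = y + of_real s * (z - y)" for s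
    have "norm (kapteyn_term \<mu> \<nu> n (l 0)) \<le> exp (- \<Lambda> * 0 - - \<Lambda> * 1) * norm (kapteyn_term \<mu> \<nu> n (l 1))"
    proof (rule norm_growth[where \<gamma>' = "\<lambda>s. - \<Lambda>" and \<gamma> = "\<lambda>s. - \<Lambda> * s" and g = "\<lambda>s. (z - y) * v n (l s) / l s"])
      fix s :: real assume s: "0 \<le> s" "s \<le> 1"
      have "l s \<in> closed_segment y z"
        using s by (auto simp: l_def in_segment scaleR_conv_of_real algebra_simps intro!: exI[of _ s])
      hence ls: "l s \<in> K" "\<rho> \<le> norm (l s)" using seg by auto
      hence ls0: "l s \<noteq> 0" using \<rho> by auto
      have "(l has_vector_derivative (z - y)) (at s)"
        unfolding l_def by (auto intro!: derivative_eq_intros)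
      from field_vector_diff_chain_at[OF this v(1)[OF n ls(1) ls0]]
      show "((\<lambda>s. kapteyn_term \<mu> \<nu> n (l s)) has_vector_derivative
          (z - y) * v n (l s) / l s * kapteyn_term \<mu> \<nu> n (l s)) (at s)"
        by (simp add: o_def mult.assoc)
      show "((\<lambda>s. - \<Lambda> * s) has_real_derivative - \<Lambda>) (at s)"
        by (auto intro!: derivative_eq_intros)
      have "norm ((z - y) * v n (l s) / l s) \<le> norm (z - y) * ((\<bar>C\<bar> + 1) * real n) / \<rho>"
        unfolding norm_divide norm_mult using C[OF n ls(1)] ls(2) \<rho>
        by (intro frac_le mult_left_mono) auto
      also have "\<dots> = \<Lambda>" by (simp add: \<Lambda>_def)
      finally show "- \<Lambda> \<le> Re ((z - y) * v n (l s) / l s)"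
        using abs_Re_le_cmod[of "(z - y) * v n (l s) / l s"] by linarith
    qed auto
    thus "norm (kapteyn_term \<mu> \<nu> n y) \<le>
        exp ((\<bar>C\<bar> + 1) * real n * norm (z - y) / \<rho>) * norm (kapteyn_term \<mu> \<nu> n z)"
      by (simp add: l_def \<Lambda>_def)
  qed (use \<open>0 < \<delta>\<close> in auto)
qed

text \<open>\<open>1 - 4 * y\<^sup>2\<close> is real only for real or purely imaginary
  \<open>y\<close>, and in the latter case it is at least 1.\<close>

lemma off_real_axis_avoids_slit:
  assumes "Im y \<noteq> 0 \<or> y = 0"
  shows "1 - 4 * y\<^sup>2 \<notin> \<real>\<^sub>\<le>\<^sub>0"
proof
  assume "1 - 4 * y\<^sup>2 \<in> \<real>\<^sub>\<le>\<^sub>0"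
  hence *: "Re (1 - 4 * y\<^sup>2) \<le> 0" "Im (1 - 4 * y\<^sup>2) = 0"
    by (auto simp: complex_nonpos_Reals_iff)
  hence "Im y \<noteq> 0" using assms by auto
  hence "Re y = 0" using *(2) by (auto simp: power2_eq_square)
  thus False using *(1) zero_le_square[of "Im y"] by (simp add: power2_eq_square del: zero_le_square)
qed

section \<open>Comparison of coefficients\<close>

text \<open>\<open>K\<close> is the compact cone with its apex 0, on which the growth bounds hold;
  \<open>V\<close> is the open connected cone without the apex, on which the two series are
  compared. \<open>L\<close> is the order to which the tail shall vanish at 0, and \<open>M\<close>
  is chosen depending on it.\<close>

lemma kapteyn_tail_bound:
  fixes \<mu> \<nu> z\<^sub>1 :: complex and a b c :: "nat \<Rightarrow> complex"
  defines "F \<equiv> kapteyn_term \<mu> \<nu>"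
  assumes "\<eta> > 0" and off_real: "\<And>z. z \<in> cball z\<^sub>1 \<eta> \<Longrightarrow> Im z \<noteq> 0"
    and power: "\<And>z. z \<in> ball z\<^sub>1 \<eta> \<Longrightarrow> summable (\<lambda>m. b m * z ^ m)"
    and kapteyn: "\<And>z. z \<in> ball z\<^sub>1 \<eta> \<Longrightarrow> summable (\<lambda>n. norm ((a n + z * c n) * F n z))"
    and eq: "\<And>z. z \<in> ball z\<^sub>1 \<eta> \<Longrightarrow> (\<Sum>m. b m * z ^ m) = (\<Sum>n. (a n + z * c n) * F n z)"
  shows "\<exists>M \<Gamma>. L < M \<and> (\<forall>t. 0 < t \<longrightarrow> t < 1 \<longrightarrow>
    norm ((\<Sum>m. b m * (of_real t * z\<^sub>1) ^ m) -
          (\<Sum>n<M. (a n + of_real t * z\<^sub>1 * c n) * F n (of_real t * z\<^sub>1))) \<le> \<Gamma> * t ^ L)"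
proof -
  define B where "B = ball z\<^sub>1 \<eta>"
  define scale where "scale = (\<lambda>(t, z). complex_of_real t * z)"
  define K where "K = scale ` ({0..1} \<times> cball z\<^sub>1 \<eta>)"
  define V where "V = scale ` ({0<..1} \<times> B)"
  have cont: "continuous_on A scale" for A
    unfolding scale_def case_prod_beta by (intro continuous_intros)
  have "compact K"
    unfolding K_def by (intro compact_continuous_image cont compact_Times) auto
  have star: "of_real t * z \<in> K" if z: "z \<in> K" and t: "0 \<le> t" "t \<le> 1" for z t
  proof -
    from z obtain s w where s: "s \<in> {0..1}" "w \<in> cball z\<^sub>1 \<eta>" and sw: "z = of_real s * w"
      by (auto simp: K_def scale_def)
    have "(t * s, w) \<in> {0..1} \<times> cball z\<^sub>1 \<eta>"
      using s t by (auto intro: mult_le_one)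
    moreover have "of_real t * z = scale (t * s, w)" by (simp add: sw scale_def)
    ultimately show ?thesis unfolding K_def by (rule rev_image_eqI)
  qed
  have slit: "1 - 4 * z\<^sup>2 \<notin> \<real>\<^sub>\<le>\<^sub>0" if "z \<in> K" for z
    using that off_real by (intro off_real_axis_avoids_slit) (auto simp: K_def scale_def)
  have "V \<subseteq> K" unfolding V_def K_def B_def by (intro image_mono Sigma_mono) auto
  have V0: "z \<noteq> 0" if "z \<in> V" for z
  proof -
    from that obtain s w where s: "s \<in> {0<..1}" "w \<in> B" and sw: "z = of_real s * w"
      by (auto simp: V_def scale_def)
    have "Im w \<noteq> 0" using off_real s by (auto simp: B_def)
    thus ?thesis using s sw by auto
  qed
  have BV: "B \<subseteq> V"
    unfolding V_def by (auto simp: scale_def intro!: image_eqI[of _ _ "(1, _)"])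
  have VI: "of_real t * z \<in> V" if "0 < t" "t \<le> 1" "z \<in> B" for t z
    using that unfolding V_def by (auto simp: scale_def intro!: image_eqI[of _ _ "(t, z)"])
  have VE: "\<exists>t z. 0 < t \<and> t \<le> 1 \<and> z \<in> B \<and> y = of_real t * z" if "y \<in> V" for y
    using that by (auto simp: V_def scale_def)
  have "open V"
  proof -
    have "V = (\<Union>t\<in>{0<..1}. (\<lambda>z. of_real t * z) ` B)"
      unfolding V_def scale_def by auto
    moreover have "open ((\<lambda>z. of_real t * z) ` B)" if "t \<in> {0<..1}" for t
      using open_scaling[of t B] that by (simp add: B_def scaleR_conv_of_real)
    ultimately show ?thesis using open_UN by metis
  qed
  have "connected V"
    unfolding V_def B_def
    by (intro connected_continuous_image cont connected_Times) auto
  \<comment> \<open>Openness leaves room to move outward along a ray; the decay from the outer point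
    later pays for leaving the ray.\<close>
  have expand: "\<exists>q>1. of_real q * z \<in> B" if "z \<in> B" for z
  proof -
    have "open ((\<lambda>q. complex_of_real q * z) -` B)"
      unfolding B_def by (intro open_vimage continuous_intros) auto
    moreover have "1 \<in> (\<lambda>q. complex_of_real q * z) -` B" using that by simp
    ultimately obtain e where "e > 0" "ball 1 e \<subseteq> (\<lambda>q. complex_of_real q * z) -` B"
      unfolding open_contains_ball by blast
    moreover from this have "1 + e / 2 \<in> ball 1 e" by (simp add: dist_real_def)
    ultimately show ?thesis by (intro exI[of _ "1 + e / 2"]) auto
  qed
  obtain \<delta> C N where \<delta>: "0 < \<delta>" and C: "0 < C"
    and ray: "\<And>n z t. n \<ge> N \<Longrightarrow> z \<in> K \<Longrightarrow> z \<noteq> 0 \<Longrightarrow> 0 < t \<Longrightarrow> t \<le> 1 \<Longrightarrow>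
      norm (F n (of_real t * z)) \<le> t powr (\<delta> * real n) * norm (F n z)"
    and seg: "\<And>n y z \<rho>. n \<ge> N \<Longrightarrow> 0 < \<rho> \<Longrightarrow> closed_segment y z \<subseteq> K - ball 0 \<rho> \<Longrightarrow>
      norm (F n y) \<le> exp (C * real n * norm (z - y) / \<rho>) * norm (F n z)"
    unfolding F_def by (rule kapteyn_term_growth[of K \<mu> \<nu>]) (use \<open>compact K\<close> star slit in auto)
  have ray': "norm (F n (of_real t * z)) \<le> norm (F n z)"
    if "n \<ge> N" "z \<in> V" "0 < t" "t \<le> 1" for n z t
  proof -
    have "t powr (\<delta> * real n) \<le> 1" using that \<delta> by (intro powr_le1) auto
    from mult_right_mono[OF this, of "norm (F n z)"]
    show ?thesis using ray[of n z t] that V0[of z] \<open>V \<subseteq> K\<close> by auto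
  qed
  have summable_B: "summable (\<lambda>n. norm (a n * F n z)) \<and> summable (\<lambda>n. norm (c n * F n z))"
    if z: "z \<in> B" for z
  proof -
    obtain q where q: "q > 1" "of_real q * z \<in> B" using expand[OF z] by blast
    define y where "y = of_real q * z"
    have z0: "z \<noteq> 0" using V0 BV z by auto
    have s1: "summable (\<lambda>n. norm ((a n + z * c n) * F n z))"
      using kapteyn z by (simp add: B_def)
    \<comment> \<open>The coefficients are taken at \<open>y\<close> but the function at
      \<open>z\<close>. Together with \<open>s1\<close> this gives two independent combinations of
      \<open>a n\<close> and \<open>c n\<close>, so that the series for \<open>a\<close> and for
      \<open>c\<close> converge separately.\<close>
    have s2: "summable (\<lambda>n. norm ((a n + y * c n) * F n z))"
    proof (rule summable_comparison_test_ev[OF _ kapteyn[of y]])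
      show "\<forall>\<^sub>F n in sequentially. norm (norm ((a n + y * c n) * F n z)) \<le> norm ((a n + y * c n) * F n y)"
        using eventually_ge_at_top[of N]
      proof eventually_elim
        case (elim n)
        have "norm (F n (of_real (1 / q) * y)) \<le> norm (F n y)"
          using elim q BV by (intro ray') (auto simp: y_def)
        moreover have "of_real (1 / q) * y = z" using q by (simp add: y_def)
        ultimately show ?case by (simp add: norm_mult mult_left_mono)
      qed
      show "y \<in> ball z\<^sub>1 \<eta>" using q by (simp add: y_def B_def)
    qed
    have yz: "y - z \<noteq> 0" using q z0 by (auto simp: y_def)
    have "summable (\<lambda>n. norm (c n * F n z))"
    proof (rule summable_comparison_test')
      show "summable (\<lambda>n. (norm ((a n + y * c n) * F n z) + norm ((a n + z * c n) * F n z)) / norm (y - z))"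
        by (intro summable_divide summable_add s1 s2)
      fix n
      have "(y - z) * (c n * F n z) = (a n + y * c n) * F n z - (a n + z * c n) * F n z"
        by (simp add: algebra_simps)
      hence "norm (y - z) * norm (c n * F n z) \<le>
          norm ((a n + y * c n) * F n z) + norm ((a n + z * c n) * F n z)"
        using norm_triangle_ineq4 by (metis norm_mult)
      thus "norm (norm (c n * F n z)) \<le>
          (norm ((a n + y * c n) * F n z) + norm ((a n + z * c n) * F n z)) / norm (y - z)"
        using yz by (simp add: field_simps)
    qed
    moreover have "summable (\<lambda>n. norm (a n * F n z))"
    proof (rule summable_comparison_test')
      show "summable (\<lambda>n. norm ((a n + z * c n) * F n z) + norm z * norm (c n * F n z))"
        by (intro summable_add s1 summable_mult calculation)
      fix n
      have "a n * F n z = (a n + z * c n) * F n z - z * (c n * F n z)"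
        by (simp add: algebra_simps)
      hence "norm (a n * F n z) \<le> norm ((a n + z * c n) * F n z) + norm (z * (c n * F n z))"
        using norm_triangle_ineq4 by metis
      thus "norm (norm (a n * F n z)) \<le> norm ((a n + z * c n) * F n z) + norm z * norm (c n * F n z)"
        by (simp add: norm_mult)
    qed
    ultimately show ?thesis by blast
  qed
  have summable_V: "summable (\<lambda>n. norm (a n * F n y)) \<and> summable (\<lambda>n. norm (c n * F n y))"
    if y: "y \<in> V" for y
  proof -
    obtain t z where tz: "0 < t" "t \<le> 1" "z \<in> B" "y = of_real t * z"
      using VE[OF y] by blast
    have "summable (\<lambda>n. norm (x n * F n y))" if "summable (\<lambda>n. norm (x n * F n z))" for x
    proof (rule summable_comparison_test_ev[OF _ that])
      show "\<forall>\<^sub>F n in sequentially. norm (norm (x n * F n y)) \<le> norm (x n * F n z)"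
        using eventually_ge_at_top[of N]
      proof eventually_elim
        case (elim n)
        thus ?case using ray'[of n z t] tz BV by (auto simp: norm_mult intro!: mult_left_mono)
      qed
    qed
    thus ?thesis using summable_B[OF tz(3)] by blast
  qed
  have local_bound: "\<exists>d h. 0 < d \<and> summable h \<and>
      (\<forall>\<^sub>F n in sequentially. \<forall>x\<in>ball y d \<inter> V. norm ((a n + x * c n) * F n x) \<le> h n)"
    if y: "y \<in> V" for y
  proof -
    obtain t z where tz: "0 < t" "t \<le> 1" "z \<in> B" "y = of_real t * z"
      using VE[OF y] by blast
    obtain q where q: "q > 1" "of_real q * z \<in> B" using expand[OF tz(3)] by blast
    define y' where "y' = of_real q * y"
    have y': "y' \<in> V"
      using VI[OF tz(1,2) q(2)] by (simp add: y'_def tz(4) mult_ac)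
    obtain r where r: "r > 0" "ball y r \<subseteq> V"
      using \<open>open V\<close> y unfolding open_contains_ball by blast
    define \<rho> where "\<rho> = norm y / 2"
    have \<rho>: "\<rho> > 0" using V0[OF y] by (simp add: \<rho>_def)
    \<comment> \<open>The first two entries keep the ball inside \<open>V\<close> and at distance at
      least \<open>\<rho>\<close> from 0. By the third, the loss
      \<open>exp (C * n * d / \<rho>)\<close> between the ball and \<open>y\<close> does not exceed
      \<open>q powr (\<delta> * n)\<close>, the gain between \<open>y\<close> and
      \<open>y'\<close>.\<close>
    define d where "d = Min {r, \<rho>, \<delta> * ln q * \<rho> / C}"
    have d: "0 < d" "d \<le> r" "d \<le> \<rho>" "d \<le> \<delta> * ln q * \<rho> / C"
      using r \<rho> \<delta> C q by (auto simp: d_def)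
    define h where "h n = norm (a n * F n y') + (norm y + d) * norm (c n * F n y')" for n
    have "summable h"
      unfolding h_def using summable_V[OF y'] by (intro summable_add summable_mult) auto
    moreover have "\<forall>\<^sub>F n in sequentially. \<forall>x\<in>ball y d \<inter> V. norm ((a n + x * c n) * F n x) \<le> h n"
      using eventually_ge_at_top[of N]
    proof eventually_elim
      case (elim n)
      show ?case
      proof
        fix x assume x: "x \<in> ball y d \<inter> V"
        have "closed_segment x y \<subseteq> ball y d"
          using x d by (intro closed_segment_subset) auto
        also have "ball y d \<subseteq> K - ball 0 \<rho>"
        proof
          fix w assume w: "w \<in> ball y d"
          have "norm y \<le> norm w + dist y w"
            using norm_triangle_sub[of y w] by (simp add: dist_norm)
          moreover have "w \<in> ball y r" using w d by simp
          hence "w \<in> K" using r \<open>V \<subseteq> K\<close> by blast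
          ultimately show "w \<in> K - ball 0 \<rho>"
            using w d by (auto simp: \<rho>_def)
        qed
        finally have "norm (F n x) \<le> exp (C * real n * norm (y - x) / \<rho>) * norm (F n y)"
          using elim \<rho> by (intro seg)
        also have "\<dots> \<le> exp (\<delta> * ln q * real n) * norm (F n y)"
        proof -
          have "norm (y - x) \<le> \<delta> * ln q * \<rho> / C"
            using x d by (simp add: dist_norm)
          hence "C * norm (y - x) / \<rho> \<le> \<delta> * ln q"
            using C \<rho> by (simp add: field_simps)
          from mult_right_mono[OF this, of "real n"]
          have "C * real n * norm (y - x) / \<rho> \<le> \<delta> * ln q * real n"
            by (simp add: mult_ac)
          thus ?thesis by (intro mult_right_mono) auto
        qed
        also have "norm (F n y) \<le> (1 / q) powr (\<delta> * real n) * norm (F n y')"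
          using ray[of n y' "1 / q"] elim y' V0[OF y'] \<open>V \<subseteq> K\<close> q by (auto simp: y'_def)
        also have "(1 / q) powr (\<delta> * real n) = exp (- (\<delta> * ln q * real n))"
          using q by (simp add: powr_def ln_div mult_ac)
        finally have Fx: "norm (F n x) \<le> norm (F n y')"
          by (simp add: mult.assoc[symmetric] flip: exp_add)
        have "norm (a n + x * c n) \<le> norm (a n) + (norm y + d) * norm (c n)"
        proof (rule norm_triangle_le, rule add_left_mono)
          have "norm x \<le> norm y + d"
            using x norm_triangle_sub[of x y] by (simp add: dist_norm norm_minus_commute)
          thus "norm (x * c n) \<le> (norm y + d) * norm (c n)"
            by (simp add: norm_mult mult_right_mono)
        qed
        hence "norm ((a n + x * c n) * F n x) \<le> (norm (a n) + (norm y + d) * norm (c n)) * norm (F n y')"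
          unfolding norm_mult using Fx d by (intro mult_mono) auto
        also have "\<dots> = h n"
          by (simp add: h_def norm_mult algebra_simps)
        finally show "norm ((a n + x * c n) * F n x) \<le> h n" .
      qed
    qed
    ultimately show ?thesis using d(1) by blast
  qed
  \<comment> \<open>Local domination by a summable series makes the sum \<open>T\<close> of the
    Kapteyn series differentiable on \<open>V\<close>.\<close>
  have "\<exists>T T'. \<forall>y\<in>V. (\<lambda>n. (a n + y * c n) * F n y) sums T y \<and>
      (\<lambda>n. deriv (\<lambda>y. (a n + y * c n) * F n y) y) sums T' y \<and> (T has_field_derivative T' y) (at y)"
  proof (rule series_and_derivative_comparison_local[OF \<open>open V\<close> _ local_bound])
    fix n y
    have "(\<lambda>y. (a n + y * c n) * F n y) field_differentiable at y"
      unfolding F_def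
      by (intro field_differentiable_mult field_differentiable_add field_differentiable_const
          field_differentiable_ident kapteyn_term_field_differentiable)
    thus "((\<lambda>y. (a n + y * c n) * F n y) has_field_derivative
        deriv (\<lambda>y. (a n + y * c n) * F n y) y) (at y)"
      by (rule field_differentiable_derivI)
  qed
  then obtain T T' where T: "\<And>y. y \<in> V \<Longrightarrow> (\<lambda>n. (a n + y * c n) * F n y) sums T y"
    and T': "\<And>y. y \<in> V \<Longrightarrow> (T has_field_derivative T' y) (at y)"
    by blast
  define g where "g y = (\<Sum>m. b m * y ^ m)" for y
  have g': "g field_differentiable at y" if y: "y \<in> V" for y
  proof -
    obtain t z where tz: "0 < t" "t \<le> 1" "z \<in> B" "y = of_real t * z"
      using VE[OF y] by blast
    obtain q where q: "q > 1" "of_real q * z \<in> B" using expand[OF tz(3)] by blast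
    have "norm y \<le> 1 * norm z"
      unfolding tz(4) norm_mult using tz by (intro mult_right_mono) auto
    \<comment> \<open>The power series converges at \<open>q * z\<close>, whose modulus exceeds that
      of \<open>y\<close>; so \<open>y\<close> is interior to its disc of convergence.\<close>
    also have "\<dots> < q * norm z" using q V0 BV tz by (intro mult_strict_right_mono) auto
    also have "\<dots> = norm (of_real q * z)" using q by (simp add: norm_mult)
    finally show ?thesis
      using termdiffs_strong[OF power[of "of_real q * z"], of y] q
      unfolding g_def[abs_def] B_def field_differentiable_def by blast
  qed
  have gT: "g y = T y" if "y \<in> V" for y
  proof (rule analytic_continuation_open[of B V g T])
    show "g holomorphic_on V"
      unfolding holomorphic_on_def using g' field_differentiable_at_within by blast
    show "T holomorphic_on V"
      unfolding holomorphic_on_def using T' field_differentiable_at_within field_differentiable_def by blast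
    show "g z = T z" if "z \<in> B" for z
      using sums_unique[OF T[of z]] eq[of z] that BV by (auto simp: g_def B_def)
  qed (use \<open>open V\<close> \<open>connected V\<close> BV that \<open>\<eta> > 0\<close> in \<open>auto simp: B_def\<close>)
  \<comment> \<open>\<open>\<delta> * M\<^sub>0 \<ge> L\<close> lets every term from
    \<open>M\<^sub>0\<close> on carry a factor \<open>t ^ L\<close>.\<close>
  obtain M\<^sub>0 :: nat where M\<^sub>0: "real L / \<delta> \<le> real M\<^sub>0" using real_arch_simple by blast
  define M where "M = Max {M\<^sub>0, N, Suc L}"
  have M: "N \<le> M" "L < M" "real L \<le> \<delta> * real M"
  proof -
    have "M\<^sub>0 \<le> M" by (simp add: M_def)
    hence "real L / \<delta> \<le> real M" using M\<^sub>0 by linarith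
    thus "real L \<le> \<delta> * real M" using \<delta> by (simp add: field_simps)
  qed (auto simp: M_def)
  have z\<^sub>1: "z\<^sub>1 \<in> B" using \<open>\<eta> > 0\<close> by (simp add: B_def)
  define h where "h n = norm (a n * F n z\<^sub>1) + norm z\<^sub>1 * norm (c n * F n z\<^sub>1)" for n
  have h: "summable h"
    unfolding h_def using summable_B[OF z\<^sub>1] by (intro summable_add summable_mult) auto
  show ?thesis
  proof (intro exI conjI allI impI)
    fix t :: real assume t: "0 < t" "t < 1"
    define y where "y = of_real t * z\<^sub>1"
    have y: "y \<in> V" using VI[of t z\<^sub>1] t z\<^sub>1 by (simp add: y_def)
    have tail: "norm ((a (n + M) + y * c (n + M)) * F (n + M) y) \<le> t ^ L * h (n + M)" for n
    proof -
      let ?n = "n + M"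
      have "norm (F ?n y) \<le> t powr (\<delta> * real ?n) * norm (F ?n z\<^sub>1)"
        unfolding y_def using t z\<^sub>1 BV V0 \<open>V \<subseteq> K\<close> M by (intro ray) auto
      also have "t powr (\<delta> * real ?n) \<le> t powr real L"
      proof (rule powr_mono')
        have "\<delta> * real M \<le> \<delta> * real ?n" using \<delta> by (intro mult_left_mono) auto
        thus "real L \<le> \<delta> * real ?n" using M by linarith
      qed (use t in auto)
      also have "t powr real L = t ^ L" using t by (simp add: powr_realpow)
      finally have Fy: "norm (F ?n y) \<le> t ^ L * norm (F ?n z\<^sub>1)"
        by (simp add: mult_right_mono)
      have "norm (a ?n + y * c ?n) \<le> norm (a ?n) + norm z\<^sub>1 * norm (c ?n)"
      proof (rule norm_triangle_le, rule add_left_mono)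
        have "norm y \<le> 1 * norm z\<^sub>1"
          unfolding y_def norm_mult using t by (intro mult_right_mono) auto
        thus "norm (y * c ?n) \<le> norm z\<^sub>1 * norm (c ?n)"
          by (simp add: norm_mult mult_right_mono)
      qed
      hence "norm ((a ?n + y * c ?n) * F ?n y) \<le>
          (norm (a ?n) + norm z\<^sub>1 * norm (c ?n)) * (t ^ L * norm (F ?n z\<^sub>1))"
        unfolding norm_mult using Fy by (intro mult_mono) auto
      also have "\<dots> = t ^ L * h ?n" by (simp add: h_def norm_mult algebra_simps)
      finally show ?thesis .
    qed
    have hM: "summable (\<lambda>n. t ^ L * h (n + M))"
      by (intro summable_mult summable_ignore_initial_segment h)
    have "g y - (\<Sum>n<M. (a n + y * c n) * F n y) = (\<Sum>n. (a (n + M) + y * c (n + M)) * F (n + M) y)"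
      using gT[OF y] T[OF y] suminf_minus_initial_segment[OF sums_summable[OF T[OF y]], of M]
      by (simp add: sums_unique)
    also have "norm \<dots> \<le> (\<Sum>n. t ^ L * h (n + M))"
      by (rule norm_suminf_le[OF tail hM])
    also have "\<dots> = (\<Sum>n. h (n + M)) * t ^ L"
      using suminf_mult[OF summable_ignore_initial_segment[OF h, of M], of "t ^ L"] by (simp add: mult_ac)
    finally show "norm ((\<Sum>m. b m * (of_real t * z\<^sub>1) ^ m) -
        (\<Sum>n<M. (a n + of_real t * z\<^sub>1 * c n) * F n (of_real t * z\<^sub>1))) \<le> (\<Sum>n. h (n + M)) * t ^ L"
      by (simp add: g_def y_def)
  qed (use M in auto)
qed

text \<open>Once the lower coefficients vanish, division by the \<open>m\<close>-th power leaves a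
  power series with value \<open>d m\<close> at 0, and the bound forces its values along the ray to
  tend to 0.\<close>

lemma powser_eq_0_of_bound:
  fixes d :: "nat \<Rightarrow> complex"
  assumes "z \<noteq> 0" and summable: "summable (\<lambda>m. d m * z ^ m)"
    and bound: "\<And>t. 0 < t \<Longrightarrow> t < 1 \<Longrightarrow> norm (\<Sum>m. d m * (of_real t * z) ^ m) \<le> \<Gamma> * t ^ L"
    and "m < L"
  shows "d m = 0"
  using \<open>m < L\<close>
proof (induction m rule: less_induct)
  case (less m)
  define g where "g y = (\<Sum>i. d (i + m) * y ^ i)" for y
  have "summable (\<lambda>i. d (i + m) * z ^ (i + m))"
    by (rule summable_ignore_initial_segment[OF summable])
  hence "summable (\<lambda>i. d (i + m) * z ^ (i + m) / z ^ m)"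
    by (rule summable_divide)
  hence sg: "summable (\<lambda>i. d (i + m) * z ^ i)"
    using \<open>z \<noteq> 0\<close> by (simp add: power_add)
  have "isCont g 0"
    unfolding g_def[abs_def] using termdiffs_strong[OF sg, of 0] \<open>z \<noteq> 0\<close> by (auto intro: DERIV_isCont)
  moreover have "((\<lambda>t. complex_of_real t * z) \<longlongrightarrow> of_real 0 * z) (at_right 0)"
    by (intro tendsto_intros)
  ultimately have lim: "((\<lambda>t. g (of_real t * z)) \<longlongrightarrow> g 0) (at_right 0)"
    by (auto intro: isCont_tendsto_compose)
  have g_le: "norm (g (of_real t * z)) \<le> \<bar>\<Gamma>\<bar> / norm z ^ m * t" if t: "0 < t" "t < 1" for t
  proof -
    define y where "y = of_real t * z"
    have "norm y < norm z" using t \<open>z \<noteq> 0\<close> by (simp add: y_def norm_mult)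
    hence sy: "summable (\<lambda>i. d i * y ^ i)" and sgy: "summable (\<lambda>i. d (i + m) * y ^ i)"
      using powser_inside[OF summable] powser_inside[OF sg] by blast+
    have "(\<Sum>i. d i * y ^ i) = (\<Sum>i. d (i + m) * y ^ (i + m)) + (\<Sum>i<m. d i * y ^ i)"
      by (rule suminf_split_initial_segment[OF sy])
    also have "(\<Sum>i<m. d i * y ^ i) = 0"
      using less by (intro sum.neutral) auto
    also have "(\<Sum>i. d (i + m) * y ^ (i + m)) = y ^ m * g y"
      unfolding g_def using suminf_mult[OF sgy, of "y ^ m"] by (simp add: power_add mult_ac)
    finally have "norm (y ^ m * g y) \<le> \<Gamma> * t ^ L"
      using bound[OF t] by (simp add: y_def)
    \<comment> \<open>As \<open>m < L\<close>, one power of \<open>t\<close> survives the division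
      by \<open>t ^ m\<close>.\<close>
    also have "\<dots> \<le> \<bar>\<Gamma>\<bar> * t ^ Suc m"
      using t less.prems by (intro mult_mono power_decreasing) auto
    finally have "t ^ m * (norm z ^ m * norm (g y)) \<le> t ^ m * (\<bar>\<Gamma>\<bar> * t)"
      using t by (simp add: norm_mult norm_power y_def power_mult_distrib mult_ac)
    hence "norm z ^ m * norm (g y) \<le> \<bar>\<Gamma>\<bar> * t"
      by (rule mult_left_le_imp_le) (use t in simp)
    thus ?thesis
      using \<open>z \<noteq> 0\<close> by (simp add: y_def field_simps)
  qed
  have "((\<lambda>t. g (of_real t * z)) \<longlongrightarrow> 0) (at_right 0)"
  proof (rule Lim_null_comparison)
    show "\<forall>\<^sub>F t in at_right 0. norm (g (of_real t * z)) \<le> \<bar>\<Gamma>\<bar> / norm z ^ m * t"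
      unfolding eventually_at_right_field using g_le by (intro exI[of _ 1]) auto
    have "((\<lambda>t. \<bar>\<Gamma>\<bar> / norm z ^ m * t) \<longlongrightarrow> \<bar>\<Gamma>\<bar> / norm z ^ m * 0) (at_right 0)"
      by (intro tendsto_intros)
    thus "((\<lambda>t. \<bar>\<Gamma>\<bar> / norm z ^ m * t) \<longlongrightarrow> 0) (at_right 0)" by simp
  qed
  hence "g 0 = 0"
    using tendsto_unique[OF _ lim] by simp
  thus ?case
    by (simp add: g_def powser_zero)
qed

section \<open>Taylor coefficients of the Kapteyn terms\<close>

lemma sums_even_odd:
  fixes f g :: "nat \<Rightarrow> complex"
  assumes "(\<lambda>s. f s * z ^ (2 * s)) sums x" "(\<lambda>s. g s * z ^ (2 * s)) sums y"
  shows "(\<lambda>m. (if even m then f (m div 2) else g (m div 2)) * z ^ m) sums (x + z * y)"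
proof -
  have "(\<lambda>m. if even m then f (m div 2) * z ^ m else 0) sums x"
  proof (subst sums_mono_reindex[of "\<lambda>s. 2 * s", symmetric])
    show "(if even m then f (m div 2) * z ^ m else 0) = 0" if "m \<notin> range ((*) 2)" for m
      using that by (auto elim!: evenE)
  qed (use assms(1) in \<open>auto simp: strict_mono_def\<close>)
  moreover have "(\<lambda>m. if odd m then g (m div 2) * z ^ m else 0) sums (z * y)"
  proof (subst sums_mono_reindex[of "\<lambda>s. 2 * s + 1", symmetric])
    show "(if odd m then g (m div 2) * z ^ m else 0) = 0" if "m \<notin> range (\<lambda>s. 2 * s + 1)" for m
      using that by (auto elim!: oddE)
  qed (use sums_mult[OF assms(2), of z] in \<open>auto simp: strict_mono_def mult_ac\<close>)
  ultimately have "(\<lambda>m. (if even m then f (m div 2) * z ^ m else 0) +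
      (if odd m then g (m div 2) * z ^ m else 0)) sums (x + z * y)"
    by (rule sums_add)
  thus ?thesis
    by (rule sums_cong[THEN iffD1, rotated]) auto
qed

text \<open>These are the coefficients of \<open>z ^ (2 * s)\<close> in the Taylor series of
  \<open>kapteyn_term \<mu> \<nu> n\<close>: the numbers \<open>beta\<close> freed of their complex
  powers, so that no logarithm enters the comparison.\<close>

definition kapteyn_coeff :: "complex \<Rightarrow> complex \<Rightarrow> nat \<Rightarrow> nat \<Rightarrow> complex" where
  "kapteyn_coeff \<mu> \<nu> n s = (if n \<le> s then
     (-1) ^ (s - n) * rGamma (\<mu> + of_nat s + 1) * rGamma (\<nu> + of_nat s + 1) *
     ((\<mu> + \<nu> + 2 * of_nat s) gchoose (s - n)) *
     ((\<mu> + \<nu> + 2 * of_nat n) / 2) ^ (2 * (s - n)) else 0)"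

lemma kapteyn_term_sums: "(\<lambda>s. kapteyn_coeff \<mu> \<nu> n s * z ^ (2 * s)) sums kapteyn_term \<mu> \<nu> n z"
proof -
  define w where "w = \<mu> + \<nu> + 2 * of_nat n"
  have "kapteyn_coeff \<mu> \<nu> n (m + n) * z ^ (2 * (m + n)) =
      z ^ (2 * n) * ((-1) ^ m * rGamma (\<mu> + of_nat n + of_nat m + 1) *
      rGamma (\<nu> + of_nat n + of_nat m + 1) *
      ((\<mu> + of_nat n + (\<nu> + of_nat n) + 2 * of_nat m) gchoose m) * ((w * z / 2)\<^sup>2) ^ m)" for m
  proof -
    have "((w * z / 2)\<^sup>2) ^ m * z ^ (2 * n) = (w / 2) ^ (2 * m) * z ^ (2 * (m + n))"
      by (simp add: power_mult power_mult_distrib power_divide power_add distrib_left)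
    moreover have "\<mu> + of_nat n + of_nat m + 1 = \<mu> + of_nat (m + n) + 1"
      "\<nu> + of_nat n + of_nat m + 1 = \<nu> + of_nat (m + n) + 1"
      "\<mu> + of_nat n + (\<nu> + of_nat n) + 2 * of_nat m = \<mu> + \<nu> + 2 * of_nat (m + n)"
      by simp_all
    moreover have "z' * (x * y) = x * (y * z')" for x y z' :: complex
      by (simp only: mult_ac)
    ultimately show ?thesis
      unfolding kapteyn_coeff_def w_def[symmetric] by (simp only: le_add2 if_True add_diff_cancel_right' mult.assoc)
  qed
  moreover have "(\<lambda>m. z ^ (2 * n) * ((-1) ^ m * rGamma (\<mu> + of_nat n + of_nat m + 1) *
      rGamma (\<nu> + of_nat n + of_nat m + 1) *
      ((\<mu> + of_nat n + (\<nu> + of_nat n) + 2 * of_nat m) gchoose m) * ((w * z / 2)\<^sup>2) ^ m)) sums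
      kapteyn_term \<mu> \<nu> n z"
    using sums_mult[OF bessel_clifford_mult_sums[of "\<mu> + of_nat n" "\<nu> + of_nat n" "(w * z / 2)\<^sup>2"], of "z ^ (2 * n)"]
    by (simp only: kapteyn_term_def bessel_entire_eq w_def mult.assoc)
  ultimately have "(\<lambda>m. kapteyn_coeff \<mu> \<nu> n (m + n) * z ^ (2 * (m + n))) sums kapteyn_term \<mu> \<nu> n z"
    by (simp only:)
  thus ?thesis
    by (subst (asm) sums_zero_iff_shift) (auto simp: kapteyn_coeff_def)
qed

text \<open>Order \<open>2 * s + 2\<close> in the tail bound covers the exponents
  \<open>2 * s\<close> and \<open>2 * s + 1\<close>; the even ones see only \<open>a\<close>, the
  odd ones only \<open>c\<close>. All terms with \<open>n \<le> s\<close> are among the first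
  \<open>M\<close>, and the others have no coefficient there.\<close>

lemma kapteyn_coefficients:
  fixes \<mu> \<nu> z\<^sub>1 :: complex and a b c :: "nat \<Rightarrow> complex"
  defines "F \<equiv> kapteyn_term \<mu> \<nu>"
  assumes "\<eta> > 0" and off_real: "\<And>z. z \<in> cball z\<^sub>1 \<eta> \<Longrightarrow> Im z \<noteq> 0"
    and power: "\<And>z. z \<in> ball z\<^sub>1 \<eta> \<Longrightarrow> summable (\<lambda>m. b m * z ^ m)"
    and kapteyn: "\<And>z. z \<in> ball z\<^sub>1 \<eta> \<Longrightarrow> summable (\<lambda>n. norm ((a n + z * c n) * F n z))"
    and eq: "\<And>z. z \<in> ball z\<^sub>1 \<eta> \<Longrightarrow> (\<Sum>m. b m * z ^ m) = (\<Sum>n. (a n + z * c n) * F n z)"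
  shows "b (2 * s) = (\<Sum>n\<le>s. kapteyn_coeff \<mu> \<nu> n s * a n)"
    and "b (2 * s + 1) = (\<Sum>n\<le>s. kapteyn_coeff \<mu> \<nu> n s * c n)"
proof -
  obtain M \<Gamma> where M: "2 * s + 2 < M" and tail: "\<And>t. 0 < t \<Longrightarrow> t < 1 \<Longrightarrow>
    norm ((\<Sum>m. b m * (of_real t * z\<^sub>1) ^ m) -
          (\<Sum>n<M. (a n + of_real t * z\<^sub>1 * c n) * F n (of_real t * z\<^sub>1))) \<le> \<Gamma> * t ^ (2 * s + 2)"
    using kapteyn_tail_bound[OF assms(2-6)[unfolded F_def], where L = "2 * s + 2"]
    unfolding F_def by blast
  define d where "d n m = (if even m then kapteyn_coeff \<mu> \<nu> n (m div 2) * a n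
      else kapteyn_coeff \<mu> \<nu> n (m div 2) * c n)" for n m
  have d: "(\<lambda>m. d n m * y ^ m) sums ((a n + y * c n) * F n y)" for n y
    using sums_even_odd[OF sums_mult[OF kapteyn_term_sums[of \<mu> \<nu> n y], of "a n", folded mult.assoc]
      sums_mult[OF kapteyn_term_sums[of \<mu> \<nu> n y], of "c n", folded mult.assoc]]
    by (simp add: d_def F_def algebra_simps cong: if_cong)
  have z\<^sub>1: "z\<^sub>1 \<noteq> 0" using off_real[of z\<^sub>1] \<open>\<eta> > 0\<close> by auto
  have sb: "summable (\<lambda>m. b m * z\<^sub>1 ^ m)" using power \<open>\<eta> > 0\<close> by simp
  define D where "D m = b m - (\<Sum>n<M. d n m)" for m
  have D_sums: "(\<lambda>m. D m * y ^ m) sums ((\<Sum>m. b m * y ^ m) - (\<Sum>n<M. (a n + y * c n) * F n y))"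
    if "summable (\<lambda>m. b m * y ^ m)" for y
    unfolding D_def left_diff_distrib sum_distrib_right
    by (intro sums_diff summable_sums[OF that] sums_sum d)
  have D0: "D m = 0" if "m < 2 * s + 2" for m
  proof (rule powser_eq_0_of_bound[OF z\<^sub>1 _ _ that])
    show "summable (\<lambda>m. D m * z\<^sub>1 ^ m)" using D_sums[OF sb] by (rule sums_summable)
    fix t :: real assume t: "0 < t" "t < 1"
    have "summable (\<lambda>m. b m * (of_real t * z\<^sub>1) ^ m)"
      using t z\<^sub>1 by (intro powser_inside[OF sb]) (simp add: norm_mult)
    from sums_unique[OF D_sums[OF this]] tail[OF t]
    show "norm (\<Sum>m. D m * (of_real t * z\<^sub>1) ^ m) \<le> \<Gamma> * t ^ (2 * s + 2)" by simp
  qed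
  have restrict: "(\<Sum>n<M. kapteyn_coeff \<mu> \<nu> n s * x n) = (\<Sum>n\<le>s. kapteyn_coeff \<mu> \<nu> n s * x n)" for x
    using M by (intro sum.mono_neutral_right) (auto simp: kapteyn_coeff_def)
  show "b (2 * s) = (\<Sum>n\<le>s. kapteyn_coeff \<mu> \<nu> n s * a n)"
    using D0[of "2 * s"] restrict[of a] by (simp add: D_def d_def)
  show "b (2 * s + 1) = (\<Sum>n\<le>s. kapteyn_coeff \<mu> \<nu> n s * c n)"
    using D0[of "2 * s + 1"] restrict[of c] by (simp add: D_def d_def)
qed

lemma beta_eq_kapteyn_coeff:
  fixes \<mu> \<nu> :: complex
  assumes "is_log lg" "k \<le> s"
  defines "w \<equiv> \<mu> + \<nu> + 2 * of_nat k"
  shows "beta lg \<mu> \<nu> s k = kapteyn_coeff \<mu> \<nu> k s * cpow lg (w / 2) w"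
proof -
  have w: "\<mu> + \<nu> + 2 * of_nat s = w + of_nat (2 * (s - k))"
    using assms by (simp add: w_def of_nat_diff)
  have "cpow lg (w / 2) (w + of_nat (2 * (s - k))) = cpow lg (w / 2) w * (w / 2) ^ (2 * (s - k))"
  proof (cases "w = 0")
    \<comment> \<open>For \<open>w = 0\<close> both sides are 1 if \<open>s = k\<close> and 0
      otherwise, since both kinds of power give 1 for \<open>0\<close> to the
      \<open>0\<close>.\<close>
    case True
    thus ?thesis by (auto simp: cpow_def)
  next
    case False
    thus ?thesis using assms(1) by (intro cpow_add_of_nat) auto
  qed
  moreover have "(-1) ^ (s + k) = ((-1) ^ (s - k) :: complex)"
    using assms(2) by (simp add: minus_one_power_iff)
  ultimately show ?thesis
    using assms(2) unfolding beta_def kapteyn_coeff_def w w_def[symmetric] by simp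
qed

section \<open>Inversion of the coefficient matrix\<close>

text \<open>The sum is the coefficient of degree \<open>N\<close> in the Lagrange interpolation
  polynomial of \<open>p\<close> at \<open>N + 1\<close> nodes, and this polynomial is
  \<open>p\<close> itself.\<close>

lemma divided_difference_eq_0:
  fixes t :: "nat \<Rightarrow> 'a :: field" and p :: "'a poly"
  assumes inj: "inj_on t {..N}" and deg: "degree p < N"
  shows "(\<Sum>i\<le>N. poly p (t i) / (\<Prod>j\<in>{..N} - {i}. t i - t j)) = 0"
proof -
  define P where "P i = (\<Prod>j\<in>{..N} - {i}. [:- t j, 1:])" for i
  define c where "c i = poly p (t i) / (\<Prod>j\<in>{..N} - {i}. t i - t j)" for i
  define L where "L = (\<Sum>i\<le>N. smult (c i) (P i))"
  have deg_P: "degree (P i) = N" if "i \<le> N" for i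
    unfolding P_def using that by (subst degree_prod_eq_sum_degree) auto
  have "lead_coeff (P i) = 1" for i
    unfolding P_def by (simp add: lead_coeff_prod)
  hence coeff_P: "coeff (P i) N = 1" if "i \<le> N" for i
    using deg_P[OF that] by metis
  have "L = p"
  proof (rule poly_eqI_degree[of "t ` {..N}"])
    fix x assume "x \<in> t ` {..N}"
    then obtain k where k: "k \<le> N" "x = t k" by auto
    have nz: "(\<Prod>j\<in>{..N} - {k}. t k - t j) \<noteq> 0"
      using k inj by (auto simp: inj_on_def)
    have "poly (P i) x = 0" if "i \<le> N" "i \<noteq> k" for i
      unfolding P_def poly_prod using that k by (intro prod_zero) auto
    hence "poly L x = (\<Sum>i\<le>N. if i = k then c k * poly (P k) x else 0)"
      unfolding L_def poly_sum by (intro sum.cong) auto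
    also have "\<dots> = c k * poly (P k) x" using k by simp
    also have "\<dots> = poly p x"
      using nz k by (simp add: c_def P_def poly_prod)
    finally show "poly L x = poly p x" .
  next
    have "degree L \<le> N"
      unfolding L_def by (intro degree_sum_le) (auto simp: deg_P intro: order_trans[OF degree_smult_le])
    thus "degree L < card (t ` {..N})" by (simp add: card_image[OF inj])
    show "degree p < card (t ` {..N})" using deg by (simp add: card_image[OF inj])
  qed
  hence "coeff L N = 0" using deg by (simp add: coeff_eq_0)
  moreover have "coeff L N = (\<Sum>i\<le>N. c i)"
    unfolding L_def coeff_sum by (intro sum.cong) (auto simp: coeff_P)
  ultimately show ?thesis by (simp add: c_def)
qed

lemma prod_of_nat_diff:
  assumes "i \<le> N"
  shows "(\<Prod>j\<in>{..N} - {i}. of_nat i - of_nat j) = (-1) ^ (N - i) * fact i * (fact (N - i) :: 'a :: field_char_0)"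
proof -
  have split: "{..N} - {i} = {..<i} \<union> {i<..N}" using assms by auto
  have "(\<Prod>j\<in>{..N} - {i}. of_nat i - of_nat j :: 'a) =
      (\<Prod>j<i. of_nat i - of_nat j) * (\<Prod>j\<in>{i<..N}. of_nat i - of_nat j)"
    unfolding split by (rule prod.union_disjoint) auto
  also have "(\<Prod>j<i. of_nat i - of_nat j :: 'a) = (\<Prod>j=1..i. of_nat j)"
    by (rule prod.reindex_bij_witness[of _ "\<lambda>j. i - j" "\<lambda>j. i - j"]) (auto simp: of_nat_diff)
  also have "\<dots> = fact i" by (simp add: fact_prod)
  also have "(\<Prod>j\<in>{i<..N}. of_nat i - of_nat j :: 'a) = (\<Prod>j=1..N - i. - of_nat j)"
    by (rule prod.reindex_bij_witness[of _ "\<lambda>j. j + i" "\<lambda>j. j - i"]) (auto simp: of_nat_diff)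
  also have "\<dots> = (-1) ^ (N - i) * fact (N - i)"
    by (simp add: fact_prod prod_uminus)
  finally show ?thesis by (simp add: mult_ac)
qed

text \<open>
  The sum is a divided difference of \<open>(4 * x + \<sigma>\<^sup>2) ^ (N - 1)\<close> in the \<open>N + 1\<close> nodes
  \<open>x = i * (i + \<sigma>)\<close>, at which \<open>4 * x + \<sigma>\<^sup>2 = (\<sigma> + 2 * i)\<^sup>2\<close>.
\<close>

lemma beta_alpha_sum:
  fixes \<sigma> :: complex
  assumes \<sigma>: "\<And>m. \<sigma> + of_nat m \<noteq> 0" and "N > 0"
  shows "(\<Sum>i\<le>N. (-1) ^ i * ((\<sigma> + 2 * of_nat N) gchoose (N - i)) * ((\<sigma> + of_nat i) gchoose i) /
    (\<sigma> + of_nat i) * (\<sigma> + 2 * of_nat i) ^ (2 * N - 1)) = 0"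
proof -
  define t where "t i = of_nat i * (of_nat i + \<sigma>)" for i
  have t_diff: "t i - t j = (of_nat i - of_nat j) * (\<sigma> + of_nat i + of_nat j)" for i j
    by (simp add: t_def algebra_simps)
  have \<sigma>2: "\<sigma> + of_nat i + of_nat j \<noteq> 0" for i j
    using \<sigma>[of "i + j"] by (simp add: add.assoc)
  have "\<sigma> \<noteq> 0" using \<sigma>[of 0] by simp
  have "inj_on t {..N}"
  proof (rule inj_onI)
    fix i j assume "t i = t j"
    hence "(of_nat i - of_nat j) * (\<sigma> + of_nat i + of_nat j) = 0"
      using t_diff[of i j] by simp
    thus "i = j" using \<sigma>2[of i j] by simp
  qed
  have "degree ([:\<sigma>\<^sup>2, 4:] ^ (N - 1)) < N"
    using degree_power_le[of "[:\<sigma>\<^sup>2, 4:]" "N - 1"] \<open>N > 0\<close> by simp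
  from divided_difference_eq_0[OF \<open>inj_on t {..N}\<close> this]
  have zero: "(\<Sum>i\<le>N. (\<sigma>\<^sup>2 + t i * 4) ^ (N - 1) / (\<Prod>j\<in>{..N} - {i}. t i - t j)) = 0"
    by (simp add: poly_power)
  have "(-1) ^ i * ((\<sigma> + 2 * of_nat N) gchoose (N - i)) * ((\<sigma> + of_nat i) gchoose i) /
      (\<sigma> + of_nat i) * (\<sigma> + 2 * of_nat i) ^ (2 * N - 1) =
    (-1) ^ N * (pochhammer \<sigma> (2 * N + 1) / \<sigma>) *
      ((\<sigma>\<^sup>2 + t i * 4) ^ (N - 1) / (\<Prod>j\<in>{..N} - {i}. t i - t j))" if "i \<le> N" for i
  proof -
    \<comment> \<open>The factors \<open>\<sigma> + i + j\<close> of the differences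
      \<open>t i - t j\<close> multiply to \<open>q\<close> without its factor at
      \<open>j = i\<close>.\<close>
    define q where "q = pochhammer (\<sigma> + of_nat i) (N + 1)"
    have w0: "\<sigma> + 2 * of_nat i \<noteq> 0" using \<sigma>2[of i i] by (simp add: algebra_simps)
    have q0: "q \<noteq> 0"
      using \<sigma>2 by (auto simp: q_def pochhammer_eq_0_iff add_eq_0_iff2)
    have "q = (\<Prod>j\<le>N. \<sigma> + of_nat i + of_nat j)"
      by (simp add: q_def pochhammer_prod atLeast0AtMost lessThan_Suc_atMost atLeast0LessThan)
    also have "\<dots> = (\<sigma> + of_nat i + of_nat i) * (\<Prod>j\<in>{..N} - {i}. \<sigma> + of_nat i + of_nat j)"
      using that by (intro prod.remove) auto
    finally have prod: "(\<Prod>j\<in>{..N} - {i}. \<sigma> + of_nat i + of_nat j) = q / (\<sigma> + 2 * of_nat i)"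
      using w0 by (simp add: field_simps)
    have den: "(\<Prod>j\<in>{..N} - {i}. t i - t j) =
        (-1) ^ (N - i) * fact i * fact (N - i) * (q / (\<sigma> + 2 * of_nat i))"
      unfolding t_diff prod.distrib prod prod_of_nat_diff[OF that] ..
    have num: "(\<sigma>\<^sup>2 + t i * 4) ^ (N - 1) = (\<sigma> + 2 * of_nat i) ^ (2 * N - 2)"
    proof -
      have "\<sigma>\<^sup>2 + t i * 4 = (\<sigma> + 2 * of_nat i)\<^sup>2"
        by (simp add: t_def power2_eq_square algebra_simps)
      thus ?thesis by (simp add: right_diff_distrib' flip: power_mult)
    qed
    have pow: "(\<sigma> + 2 * of_nat i) ^ (2 * N - 1) = (\<sigma> + 2 * of_nat i) ^ (2 * N - 2) * (\<sigma> + 2 * of_nat i)"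
    proof -
      have "2 * N - 1 = Suc (2 * N - 2)" using \<open>N > 0\<close> by simp
      thus ?thesis by (simp only: power_Suc2)
    qed
    have g1: "(\<sigma> + 2 * of_nat N) gchoose (N - i) = pochhammer (\<sigma> + of_nat i + of_nat (N + 1)) (N - i) / fact (N - i)"
      using that by (simp add: gbinomial_pochhammer' of_nat_diff algebra_simps)
    have g2: "((\<sigma> + of_nat i) gchoose i) / (\<sigma> + of_nat i) = pochhammer \<sigma> i / \<sigma> / fact i"
    proof -
      have "pochhammer (\<sigma> + 1) i * \<sigma> = pochhammer \<sigma> i * (\<sigma> + of_nat i)"
        using pochhammer_rec[of \<sigma> i] pochhammer_rec'[of \<sigma> i] by (simp add: mult_ac)
      hence "pochhammer (\<sigma> + 1) i / (\<sigma> + of_nat i) = pochhammer \<sigma> i / \<sigma>"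
        by (rule iffD2[OF frac_eq_eq[OF \<sigma> \<open>\<sigma> \<noteq> 0\<close>]])
      moreover have "(\<sigma> + of_nat i) gchoose i = pochhammer (\<sigma> + 1) i / fact i"
        by (simp add: gbinomial_pochhammer')
      moreover have "x / y / z = x / z / y" for x y z :: complex
        by simp
      ultimately show ?thesis by metis
    qed
    \<comment> \<open>The blocks have lengths \<open>i\<close>, \<open>N + 1\<close> and
      \<open>N - i\<close>: the outer ones are numerators of the two binomial coefficients and the
      middle one is \<open>q\<close>, so the common factor does not depend on
      \<open>i\<close>.\<close>
    have "pochhammer \<sigma> (2 * N + 1) = pochhammer \<sigma> (i + (N + 1 + (N - i)))"
      using that by (intro arg_cong2[of _ _ _ _ pochhammer]) auto
    also have "\<dots> = pochhammer \<sigma> i * pochhammer (\<sigma> + of_nat i) (N + 1 + (N - i))"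
      by (rule pochhammer_product')
    also have "pochhammer (\<sigma> + of_nat i) (N + 1 + (N - i)) =
        q * pochhammer (\<sigma> + of_nat i + of_nat (N + 1)) (N - i)"
      unfolding q_def by (rule pochhammer_product')
    finally have poch: "pochhammer \<sigma> (2 * N + 1) =
        pochhammer \<sigma> i * (q * pochhammer (\<sigma> + of_nat i + of_nat (N + 1)) (N - i))" .
    have sgn: "(-1) ^ N = ((-1) ^ i * (-1) ^ (N - i) :: complex)"
      using that by (simp flip: power_add)
    have alg: "e * (P / f) * (R / \<sigma> / f') * (X * w) =
        (e * e') * ((R * (q * P)) / \<sigma>) * (X / (e' * f' * f * (q / w)))"
      if "e' \<noteq> 0" "f \<noteq> 0" "f' \<noteq> 0" "w \<noteq> 0" "q \<noteq> 0" for e e' P R X w f f' q :: complex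
      using that by (simp add: mult_ac)
    have "(-1) ^ i * ((\<sigma> + 2 * of_nat N) gchoose (N - i)) * ((\<sigma> + of_nat i) gchoose i) /
      (\<sigma> + of_nat i) * (\<sigma> + 2 * of_nat i) ^ (2 * N - 1) =
      (-1) ^ i * ((\<sigma> + 2 * of_nat N) gchoose (N - i)) * (((\<sigma> + of_nat i) gchoose i) /
      (\<sigma> + of_nat i)) * (\<sigma> + 2 * of_nat i) ^ (2 * N - 1)" by simp
    also have "\<dots> = (-1) ^ N * (pochhammer \<sigma> (2 * N + 1) / \<sigma>) *
      ((\<sigma>\<^sup>2 + t i * 4) ^ (N - 1) / (\<Prod>j\<in>{..N} - {i}. t i - t j))"
      unfolding g1 g2 pow num den poch sgn by (rule alg) (use q0 w0 \<open>\<sigma> \<noteq> 0\<close> in auto)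
    finally show ?thesis .
  qed
  hence "(\<Sum>i\<le>N. (-1) ^ i * ((\<sigma> + 2 * of_nat N) gchoose (N - i)) * ((\<sigma> + of_nat i) gchoose i) /
      (\<sigma> + of_nat i) * (\<sigma> + 2 * of_nat i) ^ (2 * N - 1)) =
    (-1) ^ N * (pochhammer \<sigma> (2 * N + 1) / \<sigma>) *
      (\<Sum>i\<le>N. (\<sigma>\<^sup>2 + t i * 4) ^ (N - 1) / (\<Prod>j\<in>{..N} - {i}. t i - t j))"
    unfolding sum_distrib_left by (intro sum.cong) auto
  thus ?thesis unfolding zero by simp
qed

text \<open>Associativity gives \<open>B (A B) = B\<close>. As the diagonal of \<open>B\<close> does
  not vanish, each row of \<open>A B\<close> is determined by the earlier ones, and induction on the
  row identifies it.\<close>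

lemma triangular_left_inverse_imp_right_inverse:
  fixes A B :: "nat \<Rightarrow> nat \<Rightarrow> 'a :: field"
  assumes BA: "\<And>s j. j \<le> s \<Longrightarrow> (\<Sum>k=j..s. B s k * A k j) = (if s = j then 1 else 0)"
    and "j \<le> s"
  shows "(\<Sum>k=j..s. A s k * B k j) = (if s = j then 1 else 0)"
  using \<open>j \<le> s\<close>
proof (induction s rule: less_induct)
  case (less s)
  define M where "M m = (\<Sum>k=j..m. A m k * B k j)" for m
  have Bss: "B s s \<noteq> 0" using BA[of s s] by auto
  have "(\<Sum>m=j..s. B s m * M m) = (\<Sum>m\<in>{j..s}. \<Sum>k\<in>{k. k \<in> {j..s} \<and> k \<le> m}. B s m * A m k * B k j)"
    unfolding M_def sum_distrib_left mult.assoc by (intro sum.cong) auto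
  also have "\<dots> = (\<Sum>k\<in>{j..s}. \<Sum>m\<in>{m. m \<in> {j..s} \<and> k \<le> m}. B s m * A m k * B k j)"
    by (rule sum.swap_restrict) auto
  also have "\<dots> = (\<Sum>k\<in>{j..s}. (\<Sum>m=k..s. B s m * A m k) * B k j)"
    unfolding sum_distrib_right by (intro sum.cong) auto
  also have "\<dots> = (\<Sum>k\<in>{j..s}. if k = s then B s j else 0)"
    by (intro sum.cong) (auto simp: BA)
  also have "\<dots> = B s j" using less.prems by simp
  finally have BM: "(\<Sum>m=j..s. B s m * M m) = B s j" .
  show ?case
  proof (cases "s = j")
    case True
    thus ?thesis using BM Bss by (simp add: M_def)
  next
    case False
    have "B s j = (\<Sum>m=j..<s. B s m * M m) + B s s * M s"
      using BM less.prems False by (simp add: sum.last_plus add.commute)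
    also have "(\<Sum>m=j..<s. B s m * M m) = (\<Sum>m=j..<s. if m = j then B s j else 0)"
      using less.IH by (intro sum.cong) (auto simp: M_def)
    also have "\<dots> = B s j" using less.prems False by simp
    finally show ?thesis using Bss False by (simp add: M_def)
  qed
qed

text \<open>The two binomial coefficients join to a Pochhammer symbol of length \<open>N\<close>,
  whose last factor is the denominator. What remains is a polynomial in
  \<open>\<sigma>\<close>.\<close>

lemma gbinomial_mult_pochhammer:
  fixes \<sigma> :: complex
  assumes "i \<le> N" "N > 0" "\<sigma> + of_nat N + of_nat i \<noteq> 0"
  shows "((\<sigma> + of_nat N + of_nat i) gchoose (N - i)) * ((\<sigma> + 2 * of_nat i) gchoose i) / (\<sigma> + of_nat N + of_nat i) =
    pochhammer (\<sigma> + of_nat i + 1) (N - 1) / (fact i * fact (N - i))"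
proof -
  have g1: "(\<sigma> + of_nat N + of_nat i) gchoose (N - i) = pochhammer (\<sigma> + of_nat i + 1 + of_nat i) (N - i) / fact (N - i)"
    using assms(1) by (simp add: gbinomial_pochhammer' of_nat_diff algebra_simps)
  have g2: "(\<sigma> + 2 * of_nat i) gchoose i = pochhammer (\<sigma> + of_nat i + 1) i / fact i"
    by (simp add: gbinomial_pochhammer' algebra_simps)
  have "pochhammer (\<sigma> + of_nat i + 1) i * pochhammer (\<sigma> + of_nat i + 1 + of_nat i) (N - i) =
      pochhammer (\<sigma> + of_nat i + 1) N"
    using pochhammer_product[OF assms(1), of "\<sigma> + of_nat i + 1"] by simp
  also have "\<dots> = pochhammer (\<sigma> + of_nat i + 1) (N - 1) * (\<sigma> + of_nat N + of_nat i)"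
    using \<open>N > 0\<close> pochhammer_rec'[of "\<sigma> + of_nat i + 1" "N - 1"]
    by (simp add: of_nat_diff algebra_simps)
  finally show ?thesis
    unfolding g1 g2 using assms(3) by (simp add: divide_simps mult_ac)
qed

text \<open>\<open>A\<close> and \<open>B\<close> are \<open>alpha\<close> and \<open>beta\<close>
  stripped of Gamma functions, powers of 2 and branch-dependent powers. \<open>B A = 1\<close> is
  \<open>beta_alpha_sum\<close>; the claim is the entry \<open>(N, 0)\<close> of
  \<open>A B = 1\<close>, up to the factor \<open>w N\<close>.\<close>

lemma alpha_beta_sum_generic:
  fixes \<sigma> :: complex
  assumes \<sigma>: "\<And>m. \<sigma> + of_nat m \<noteq> 0" and "N > 0"
  shows "(\<Sum>i\<le>N. (-1) ^ i * (\<sigma> + 2 * of_nat i)\<^sup>2 * (pochhammer (\<sigma> + of_nat i + 1) (N - 1) / (fact i * fact (N - i))) *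
    \<sigma> ^ (2 * i) * (\<sigma> + 2 * of_nat N) ^ (2 * (N - i))) = 0"
proof -
  define w where "w k = \<sigma> + 2 * of_nat k" for k
  define A where "A s k = (w k)\<^sup>2 * ((\<sigma> + of_nat s + of_nat k) gchoose (s - k)) /
    ((\<sigma> + of_nat s + of_nat k) * w s) * w s ^ (2 * (s - k))" for s k
  define B where "B s k = (-1) ^ (s - k) * (w s gchoose (s - k)) * w k ^ (2 * (s - k))" for s k
  have w0: "w k \<noteq> 0" for k using \<sigma>[of "2 * k"] by (simp add: w_def)
  have "(\<Sum>k=j..s. B s k * A k j) = (if s = j then 1 else 0)" if "j \<le> s" for s j
  proof (cases "s = j")
    case True
    have "\<sigma> + of_nat j + of_nat j = w j" by (simp add: w_def)
    thus ?thesis using True w0[of j] by (simp add: A_def B_def power2_eq_square)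
  next
    case False
    define M where "M = s - j"
    have M: "M > 0" "s = M + j" using that False by (auto simp: M_def)
    \<comment> \<open>Column \<open>j\<close> is column 0 with \<open>\<sigma>\<close> replaced by
      \<open>w j\<close>, and this keeps the denominators nonzero.\<close>
    have \<sigma>': "w j + of_nat m \<noteq> 0" for m using \<sigma>[of "2 * j + m"] by (simp add: w_def add_ac)
    have "(\<Sum>k=j..s. B s k * A k j) = (\<Sum>i\<le>M. B s (i + j) * A (i + j) j)"
      unfolding M(2) by (rule sum.reindex_bij_witness[of _ "\<lambda>i. i + j" "\<lambda>k. k - j"]) auto
    also have "\<dots> = (\<Sum>i\<le>M. (-1) ^ M * (w j)\<^sup>2 * ((-1) ^ i * ((w j + 2 * of_nat M) gchoose (M - i)) *
        ((w j + of_nat i) gchoose i) / (w j + of_nat i) * (w j + 2 * of_nat i) ^ (2 * M - 1)))"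
    proof (intro sum.cong refl)
      fix i assume "i \<in> {..M}"
      hence i: "i \<le> M" by simp
      have e: "w s = w j + 2 * of_nat M" "w (i + j) = w j + 2 * of_nat i"
        "\<sigma> + of_nat (i + j) + of_nat j = w j + of_nat i" "s - (i + j) = M - i" "i + j - j = i"
        by (simp_all add: w_def M(2))
      have nz: "w j + 2 * of_nat i \<noteq> 0" "w j + of_nat i \<noteq> 0"
        using w0[of "i + j"] \<sigma>'[of i] by (simp_all add: e)
      have "(w j + 2 * of_nat i) ^ (2 * (M - i)) * (w j + 2 * of_nat i) ^ (2 * i) =
          (w j + 2 * of_nat i) ^ (2 * M - 1) * (w j + 2 * of_nat i)"
      proof -
        have "2 * (M - i) + 2 * i = Suc (2 * M - 1)" using i M(1) by auto
        thus ?thesis by (simp only: power_add[symmetric] power_Suc2)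
      qed
      hence p: "(w j + 2 * of_nat i) ^ (2 * (M - i)) * ((w j + 2 * of_nat i) ^ (2 * i) / (w j + 2 * of_nat i)) =
          (w j + 2 * of_nat i) ^ (2 * M - 1)"
        using nz by (simp add: field_simps)
      have sgn: "(-1) ^ (M - i) = ((-1) ^ M * (-1) ^ i :: complex)"
        using i by (simp add: minus_one_power_iff)
      show "B s (i + j) * A (i + j) j = (-1) ^ M * (w j)\<^sup>2 * ((-1) ^ i * ((w j + 2 * of_nat M) gchoose (M - i)) *
        ((w j + of_nat i) gchoose i) / (w j + of_nat i) * (w j + 2 * of_nat i) ^ (2 * M - 1))"
        unfolding A_def B_def e p[symmetric] sgn by (simp add: mult_ac)
    qed
    also have "\<dots> = 0"
      unfolding sum_distrib_left[symmetric] using beta_alpha_sum[OF \<sigma>' M(1)] by simp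
    finally show ?thesis using False by simp
  qed
  from triangular_left_inverse_imp_right_inverse[of B A, OF this, of 0 N]
  have "(\<Sum>i\<le>N. A N i * B i 0) = 0"
    using \<open>N > 0\<close> by (simp add: atMost_atLeast0)
  also have "(\<Sum>i\<le>N. A N i * B i 0) = (\<Sum>i\<le>N. (-1) ^ i * (\<sigma> + 2 * of_nat i)\<^sup>2 *
      (pochhammer (\<sigma> + of_nat i + 1) (N - 1) / (fact i * fact (N - i))) *
      \<sigma> ^ (2 * i) * (\<sigma> + 2 * of_nat N) ^ (2 * (N - i)) / w N)"
  proof (intro sum.cong refl)
    fix i assume "i \<in> {..N}"
    hence i: "i \<le> N" by simp
    have "\<sigma> + of_nat N + of_nat i \<noteq> 0" using \<sigma>[of "N + i"] by (simp add: add_ac)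
    note pochhammer = gbinomial_mult_pochhammer[OF i \<open>N > 0\<close> this]
    show "A N i * B i 0 = (-1) ^ i * (\<sigma> + 2 * of_nat i)\<^sup>2 *
      (pochhammer (\<sigma> + of_nat i + 1) (N - 1) / (fact i * fact (N - i))) *
      \<sigma> ^ (2 * i) * (\<sigma> + 2 * of_nat N) ^ (2 * (N - i)) / w N"
      unfolding pochhammer[symmetric] by (simp add: A_def B_def w_def mult_ac)
  qed
  finally show ?thesis
    using w0[of N] by (simp only: sum_divide_distrib[symmetric] divide_eq_0_iff) simp
qed

lemma alpha_beta_sum:
  fixes \<sigma> :: complex
  assumes "N > 0"
  shows "(\<Sum>i\<le>N. (-1) ^ i * (\<sigma> + 2 * of_nat i)\<^sup>2 * (pochhammer (\<sigma> + of_nat i + 1) (N - 1) / (fact i * fact (N - i))) *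
    \<sigma> ^ (2 * i) * (\<sigma> + 2 * of_nat N) ^ (2 * (N - i))) = 0"
    (is "?S \<sigma> = 0")
proof -
  define p :: "complex poly" where "p = (\<Sum>i\<le>N. smult ((-1) ^ i / (fact i * fact (N - i)))
    ([:2 * of_nat i, 1:]\<^sup>2 * (\<Prod>l<N - 1. [:of_nat i + 1 + of_nat l, 1:]) *
     [:0, 1:] ^ (2 * i) * [:2 * of_nat N, 1:] ^ (2 * (N - i))))"
  have p: "poly p x = ?S x" for x
    unfolding p_def poly_sum
    by (intro sum.cong) (simp_all add: poly_power poly_prod pochhammer_prod atLeast0LessThan add_ac)
  have "poly p (of_nat (Suc n)) = 0" for n
    unfolding p
  proof (rule alpha_beta_sum_generic[OF _ assms])
    show "of_nat (Suc n) + of_nat m \<noteq> (0 :: complex)" for m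
      by (simp del: of_nat_Suc flip: of_nat_add)
  qed
  \<comment> \<open>At a positive integer no denominator of the generic case vanishes, so all
    positive integers are roots.\<close>
  hence "range (\<lambda>n. of_nat (Suc n)) \<subseteq> {x. poly p x = 0}" by auto
  moreover have "infinite (range (\<lambda>n. of_nat (Suc n) :: complex))"
    by (intro range_inj_infinite injI) (simp del: of_nat_Suc)
  ultimately have "p = 0"
    using poly_roots_finite finite_subset by blast
  thus ?thesis using p[of \<sigma>] by simp
qed

text \<open>Only row \<open>s\<close> of \<open>alpha\<close> is assumed to be defined, so the
  inversion of triangular matrices cannot be applied to \<open>alpha\<close> and \<open>beta\<close>
  themselves. Off the diagonal the entry is reduced to the polynomial identity
  \<open>alpha_beta_sum\<close>.\<close>

lemma alpha_beta_inverse: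
  fixes \<mu> \<nu> :: complex
  assumes lg: "is_log lg" and defd: "\<And>k. k \<le> s \<Longrightarrow> alpha_defined \<mu> \<nu> s k" and "j \<le> s"
  shows "(\<Sum>k=j..s. alpha lg \<mu> \<nu> s k * beta lg \<mu> \<nu> k j) = (if s = j then 1 else 0)"
proof -
  define \<sigma> where "\<sigma> = \<mu> + \<nu> + 2 * of_nat j"
  define N where "N = s - j"
  have s: "s = N + j" using \<open>j \<le> s\<close> by (simp add: N_def)
  define w where "w = \<sigma> + 2 * of_nat N"
  \<comment> \<open>The exponents occurring in \<open>alpha\<close> and \<open>beta\<close> differ
    from \<open>- w\<close> and \<open>\<sigma>\<close> by even integers, so \<open>Q\<close>
    carries the whole dependence on the logarithm and is common to all \<open>i\<close>.\<close>
  define Q where "Q = cpow lg (w / 2) (- w) * cpow lg (\<sigma> / 2) \<sigma>"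
  have w: "\<mu> + \<nu> + 2 * of_nat s = w" by (simp add: w_def \<sigma>_def s)
  have w0: "w \<noteq> 0" using defd[of s] unfolding alpha_defined_def w by simp
  have summand: "alpha lg \<mu> \<nu> s (i + j) * beta lg \<mu> \<nu> (i + j) j = Q / (w * 4 ^ N) *
      ((-1) ^ i * (\<sigma> + 2 * of_nat i)\<^sup>2 * (((\<sigma> + of_nat N + of_nat i) gchoose (N - i)) *
        ((\<sigma> + 2 * of_nat i) gchoose i) / (\<sigma> + of_nat N + of_nat i)) * \<sigma> ^ (2 * i) * w ^ (2 * (N - i)))"
    if i: "i \<le> N" for i
  proof -
    let ?k = "i + j"
    have k: "?k \<le> s" using i by (simp add: s)
    have Gamma1: "Gamma (x + of_nat ?k + 1) * rGamma (x + of_nat ?k + 1) = 1"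
      if "x + of_nat ?k + 1 \<notin> \<int>\<^sub>\<le>\<^sub>0" for x :: complex
      using that by (simp add: rGamma_inverse_Gamma Gamma_eq_zero_iff)
    have G: "Gamma (\<mu> + of_nat ?k + 1) * rGamma (\<mu> + of_nat ?k + 1) = 1"
      "Gamma (\<nu> + of_nat ?k + 1) * rGamma (\<nu> + of_nat ?k + 1) = 1"
      using defd[OF k] unfolding alpha_defined_def by (blast intro: Gamma1)+
    have e: "\<mu> + \<nu> + 2 * of_nat ?k = \<sigma> + 2 * of_nat i" "\<mu> + \<nu> + of_nat s + of_nat ?k = \<sigma> + of_nat N + of_nat i"
      "s - ?k = N - i" "?k - j = i"
      by (simp_all add: \<sigma>_def s)
    have "- (\<sigma> + 2 * of_nat i) = - w + of_nat (2 * (N - i))"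
      using i by (simp add: w_def of_nat_diff)
    hence c1: "cpow lg (w / 2) (- (\<sigma> + 2 * of_nat i)) = cpow lg (w / 2) (- w) * (w / 2) ^ (2 * (N - i))"
      using cpow_add_of_nat[OF lg, of "w / 2" "- w" "2 * (N - i)"] w0 by simp
    have "(w / 2) ^ (2 * (N - i)) * (\<sigma> / 2) ^ (2 * i) = w ^ (2 * (N - i)) * \<sigma> ^ (2 * i) / 4 ^ N"
    proof -
      have "(4 :: complex) ^ N = 4 ^ (N - i) * 4 ^ i" using i by (simp flip: power_add)
      thus ?thesis by (simp add: power_mult power_divide)
    qed
    hence c2: "cpow lg (w / 2) (- (\<sigma> + 2 * of_nat i)) * ((\<sigma> / 2) ^ (2 * i) * cpow lg (\<sigma> / 2) \<sigma>) =
        Q * (w ^ (2 * (N - i)) * \<sigma> ^ (2 * i) / 4 ^ N)"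
      unfolding c1 Q_def by (simp only: mult_ac)
    have "alpha lg \<mu> \<nu> s ?k * beta lg \<mu> \<nu> ?k j =
        (Gamma (\<mu> + of_nat ?k + 1) * rGamma (\<mu> + of_nat ?k + 1)) *
        (Gamma (\<nu> + of_nat ?k + 1) * rGamma (\<nu> + of_nat ?k + 1)) *
        (cpow lg (w / 2) (- (\<sigma> + 2 * of_nat i)) * ((\<sigma> / 2) ^ (2 * i) * cpow lg (\<sigma> / 2) \<sigma>)) *
        ((-1) ^ i * (\<sigma> + 2 * of_nat i)\<^sup>2 * ((\<sigma> + of_nat N + of_nat i) gchoose (N - i)) *
        ((\<sigma> + 2 * of_nat i) gchoose i) / ((\<sigma> + of_nat N + of_nat i) * w))"
      unfolding alpha_def beta_eq_kapteyn_coeff[OF lg le_add2] kapteyn_coeff_def w e \<sigma>_def[symmetric]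
      by simp
    thus ?thesis unfolding G c2 by (simp add: mult_ac)
  qed
  have "(\<Sum>k=j..s. alpha lg \<mu> \<nu> s k * beta lg \<mu> \<nu> k j) =
      (\<Sum>i\<le>N. alpha lg \<mu> \<nu> s (i + j) * beta lg \<mu> \<nu> (i + j) j)"
    unfolding s by (rule sum.reindex_bij_witness[of _ "\<lambda>i. i + j" "\<lambda>k. k - j"]) auto
  also have "\<dots> = (if s = j then 1 else 0)"
  proof (cases "N = 0")
    case True
    have "alpha lg \<mu> \<nu> s (0 + j) * beta lg \<mu> \<nu> (0 + j) j = Q"
      using summand[of 0] w0 True by (simp add: w_def power2_eq_square)
    \<comment> \<open>For \<open>N = 0\<close> the bases coincide and the exponents
      \<open>- w\<close> and \<open>w\<close> cancel.\<close>
    moreover have "Q = 1"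
      using w0 True by (simp add: Q_def w_def cpow_def flip: exp_add)
    ultimately show ?thesis using True by (simp add: s)
  next
    case False
    have "(\<Sum>i\<le>N. alpha lg \<mu> \<nu> s (i + j) * beta lg \<mu> \<nu> (i + j) j) = Q / (w * 4 ^ N) *
      (\<Sum>i\<le>N. (-1) ^ i * (\<sigma> + 2 * of_nat i)\<^sup>2 * (pochhammer (\<sigma> + of_nat i + 1) (N - 1) / (fact i * fact (N - i))) *
        \<sigma> ^ (2 * i) * w ^ (2 * (N - i)))"
      unfolding sum_distrib_left
    proof (intro sum.cong refl)
      fix i assume "i \<in> {..N}"
      hence i: "i \<le> N" by simp
      hence "\<mu> + \<nu> + of_nat s + of_nat (i + j) \<noteq> 0"
        using defd[of "i + j"] by (simp add: s alpha_defined_def)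
      hence "\<sigma> + of_nat N + of_nat i \<noteq> 0" by (simp add: \<sigma>_def s add_ac)
      from gbinomial_mult_pochhammer[OF i _ this] False
      show "alpha lg \<mu> \<nu> s (i + j) * beta lg \<mu> \<nu> (i + j) j = Q / (w * 4 ^ N) *
        ((-1) ^ i * (\<sigma> + 2 * of_nat i)\<^sup>2 * (pochhammer (\<sigma> + of_nat i + 1) (N - 1) / (fact i * fact (N - i))) *
          \<sigma> ^ (2 * i) * w ^ (2 * (N - i)))"
        unfolding summand[OF i] by simp
    qed
    thus ?thesis
      using alpha_beta_sum[of N \<sigma>] False by (simp add: w_def s)
  qed
  finally show ?thesis .
qed

lemma alpha_inversion:
  fixes \<mu> \<nu> :: complex and x y :: "nat \<Rightarrow> complex"
  assumes lg: "is_log lg" and defd: "\<And>k. k \<le> s \<Longrightarrow> alpha_defined \<mu> \<nu> s k"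
    and y: "\<And>k. y k = (\<Sum>j=0..k. beta lg \<mu> \<nu> k j * x j)"
  shows "x s = (\<Sum>k=0..s. alpha lg \<mu> \<nu> s k * y k)"
proof -
  have "(\<Sum>k=0..s. alpha lg \<mu> \<nu> s k * y k) =
      (\<Sum>k\<in>{0..s}. \<Sum>j\<in>{j. j \<in> {0..s} \<and> j \<le> k}. alpha lg \<mu> \<nu> s k * beta lg \<mu> \<nu> k j * x j)"
    unfolding y sum_distrib_left mult.assoc by (intro sum.cong) auto
  also have "\<dots> = (\<Sum>j\<in>{0..s}. \<Sum>k\<in>{k. k \<in> {0..s} \<and> j \<le> k}. alpha lg \<mu> \<nu> s k * beta lg \<mu> \<nu> k j * x j)"
    by (rule sum.swap_restrict) auto
  also have "\<dots> = (\<Sum>j\<in>{0..s}. (\<Sum>k=j..s. alpha lg \<mu> \<nu> s k * beta lg \<mu> \<nu> k j) * x j)"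
    unfolding sum_distrib_right by (intro sum.cong) auto
  also have "\<dots> = (\<Sum>j\<in>{0..s}. if j = s then x s else 0)"
    by (intro sum.cong refl) (use alpha_beta_inverse[OF lg defd] in auto)
  also have "\<dots> = x s" by simp
  finally show ?thesis ..
qed

section \<open>From Bessel products to Kapteyn terms, and the conclusion\<close>

lemma bessel_JJ_eq_kapteyn_term:
  fixes \<mu> \<nu> :: complex and n :: nat
  assumes "is_log lg" "z \<noteq> 0"
  defines "w \<equiv> \<mu> + \<nu> + 2 * of_nat n"
  shows "bessel_JJ lg \<mu> \<nu> n z = cpow lg z (\<mu> + \<nu>) * (cpow lg (w / 2) w * kapteyn_term \<mu> \<nu> n z)"
proof -
  have "cpow lg z w = cpow lg z (\<mu> + \<nu>) * z ^ (2 * n)"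
    using cpow_add_of_nat[OF assms(1,2), of "\<mu> + \<nu>" "2 * n"] by (simp add: w_def)
  thus ?thesis
    using bessel_JJ_eq[OF assms(1,2), of \<mu> \<nu> n]
    unfolding kapteyn_term_def w_def[symmetric] by (simp add: mult_ac)
qed

theorem theorem5:
  fixes \<mu> \<nu> :: complex
    and b a c :: "nat \<Rightarrow> complex"
    and f :: "complex \<Rightarrow> complex"
    and \<Omega> :: "complex set"
    and lg :: "complex \<Rightarrow> complex"
  assumes lg: "is_log lg"
    and domain: "open \<Omega>" "connected \<Omega>" "\<Omega> \<noteq> {}"
    and power_abs: "\<And>z. z \<in> \<Omega> \<Longrightarrow> summable (\<lambda>m. norm (b m * z ^ m))"
    and power_sum: "\<And>z. z \<in> \<Omega> \<Longrightarrow> f z = (\<Sum>m. b m * z ^ m)"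
    and kapteyn_abs: "\<And>z. z \<in> \<Omega> - {0} \<Longrightarrow>
           summable (\<lambda>n. norm ((a n + z * c n) * bessel_JJ lg \<mu> \<nu> n z))"
    and kapteyn_sum: "\<And>z. z \<in> \<Omega> - {0} \<Longrightarrow>
           cpow lg z (\<mu> + \<nu>) * f z = (\<Sum>n. (a n + z * c n) * bessel_JJ lg \<mu> \<nu> n z)"
  shows "(\<forall>s. (\<forall>k\<le>s. alpha_defined \<mu> \<nu> s k) \<longrightarrow>
             a s = (\<Sum>k=0..s. alpha lg \<mu> \<nu> s k * b (2 * k)) \<and>
             c s = (\<Sum>k=0..s. alpha lg \<mu> \<nu> s k * b (2 * k + 1))) \<and>
         (\<forall>s. b (2 * s) = (\<Sum>k=0..s. beta lg \<mu> \<nu> s k * a k) \<and>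
              b (2 * s + 1) = (\<Sum>k=0..s. beta lg \<mu> \<nu> s k * c k))"
proof -
  \<comment> \<open>These branch constants of the Bessel products are absorbed into \<open>a\<close>
    and \<open>c\<close>, so that only entire functions are compared.\<close>
  define W where "W n = cpow lg ((\<mu> + \<nu> + 2 * of_nat n) / 2) (\<mu> + \<nu> + 2 * of_nat n)" for n
  \<comment> \<open>A ball off the real axis is wanted: its rays to the origin avoid the slit of
    \<open>csqrt\<close>, and it omits 0, where nothing is assumed on the Bessel products.\<close>
  have "\<exists>z\<in>\<Omega>. Im z \<noteq> 0"
  proof -
    obtain z where z: "z \<in> \<Omega>" using domain by blast
    then obtain e where e: "e > 0" "ball z e \<subseteq> \<Omega>" using domain(1) open_contains_ball by blast
    have "z + \<i> * of_real (e / 2) \<in> ball z e"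
      using e(1) by (simp add: dist_norm norm_mult)
    moreover have "Im z \<noteq> 0 \<or> Im (z + \<i> * of_real (e / 2)) \<noteq> 0" using e(1) by auto
    ultimately show ?thesis using z e(2) by blast
  qed
  then obtain z\<^sub>1 where "z\<^sub>1 \<in> \<Omega> \<inter> {z. Im z \<noteq> 0}" by blast
  moreover have "open (\<Omega> \<inter> {z. Im z \<noteq> 0})"
    by (intro open_Int domain open_Collect_neq continuous_intros)
  ultimately obtain \<eta> where \<eta>: "\<eta> > 0" "cball z\<^sub>1 \<eta> \<subseteq> \<Omega> \<inter> {z. Im z \<noteq> 0}"
    unfolding open_contains_cball by blast
  have ball: "z \<in> \<Omega> - {0}" "z \<in> \<Omega>" "z \<noteq> 0" if "z \<in> ball z\<^sub>1 \<eta>" for z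
    using subsetD[OF \<eta>(2), of z] that by auto
  have JJ: "(a n + z * c n) * bessel_JJ lg \<mu> \<nu> n z =
      cpow lg z (\<mu> + \<nu>) * ((W n * a n + z * (W n * c n)) * kapteyn_term \<mu> \<nu> n z)" if "z \<noteq> 0" for n z
    unfolding bessel_JJ_eq_kapteyn_term[OF lg that] W_def by (simp add: algebra_simps)
  have P0: "cpow lg z (\<mu> + \<nu>) \<noteq> 0" if "z \<noteq> 0" for z
    using that by (simp add: cpow_def)
  have kabs: "summable (\<lambda>n. norm ((W n * a n + z * (W n * c n)) * kapteyn_term \<mu> \<nu> n z))"
    if z: "z \<in> ball z\<^sub>1 \<eta>" for z
  proof -
    have "summable (\<lambda>n. norm (cpow lg z (\<mu> + \<nu>)) *
        norm ((W n * a n + z * (W n * c n)) * kapteyn_term \<mu> \<nu> n z))"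
      using kapteyn_abs[OF ball(1)[OF z]] unfolding JJ[OF ball(3)[OF z]] by (simp add: norm_mult)
    thus ?thesis
      using P0[OF ball(3)[OF z]] by (simp only: summable_cmult_iff norm_eq_zero) simp
  qed
  have ksum: "(\<Sum>m. b m * z ^ m) = (\<Sum>n. (W n * a n + z * (W n * c n)) * kapteyn_term \<mu> \<nu> n z)"
    if z: "z \<in> ball z\<^sub>1 \<eta>" for z
  proof -
    have "cpow lg z (\<mu> + \<nu>) * f z = cpow lg z (\<mu> + \<nu>) *
        (\<Sum>n. (W n * a n + z * (W n * c n)) * kapteyn_term \<mu> \<nu> n z)"
      using kapteyn_sum[OF ball(1)[OF z]] suminf_mult[OF summable_norm_cancel[OF kabs[OF z]], of "cpow lg z (\<mu> + \<nu>)"]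
      unfolding JJ[OF ball(3)[OF z]] by simp
    thus ?thesis
      using P0[OF ball(3)[OF z]] power_sum[OF ball(2)[OF z]] by simp
  qed
  \<comment> \<open>Moved from the sequences to the matrix, \<open>W\<close> supplies the complex
    power by which \<open>beta\<close> differs from \<open>kapteyn_coeff\<close>.\<close>
  have beta: "(\<Sum>n\<le>s. kapteyn_coeff \<mu> \<nu> n s * (W n * x n)) = (\<Sum>k=0..s. beta lg \<mu> \<nu> s k * x k)" for s x
    unfolding atMost_atLeast0 W_def
    by (intro sum.cong refl) (simp add: beta_eq_kapteyn_coeff[OF lg])
  have off_real: "Im z \<noteq> 0" if "z \<in> cball z\<^sub>1 \<eta>" for z
    using \<eta>(2) that by blast
  have psum: "summable (\<lambda>m. b m * z ^ m)" if "z \<in> ball z\<^sub>1 \<eta>" for z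
    by (rule summable_norm_cancel[OF power_abs[OF ball(2)[OF that]]])
  note b = kapteyn_coefficients[where b = b and a = "\<lambda>n. W n * a n" and c = "\<lambda>n. W n * c n",
      OF \<eta>(1) off_real psum kabs ksum, unfolded beta]
  show ?thesis
  proof (intro conjI allI impI)
    fix s assume "\<forall>k\<le>s. alpha_defined \<mu> \<nu> s k"
    hence defd: "alpha_defined \<mu> \<nu> s k" if "k \<le> s" for k using that by simp
    show "a s = (\<Sum>k=0..s. alpha lg \<mu> \<nu> s k * b (2 * k))"
      by (rule alpha_inversion[OF lg defd b(1)])
    show "c s = (\<Sum>k=0..s. alpha lg \<mu> \<nu> s k * b (2 * k + 1))"
      by (rule alpha_inversion[OF lg defd b(2)])
  next
    fix s
    show "b (2 * s) = (\<Sum>k=0..s. beta lg \<mu> \<nu> s k * a k)" by (rule b(1))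
    show "b (2 * s + 1) = (\<Sum>k=0..s. beta lg \<mu> \<nu> s k * c k)" by (rule b(2))
  qed
qed

end
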